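(* Let $\mathcal{Q}$ be a finite set of positive integers with largest element $q$, and consider the metatile-generating digraph for restricted-overlap tiling with squares and $\mathcal{Q}$-combs, where this digraph has no common node but has errant loops and a pseudo-common node $\mathcal{P}$. If the digraph has - plain outer cycles of lengths $l_{\mathrm{o}i}$ that contain $k_{\mathrm{o}i}$ combs ($i=1,\ldots,N_{\mathrm{o}}$); - non-plain outer cycles of lengths $\tilde l_{\mathrm{o}i}$ that contain $\tilde k_{\mathrm{o}i}$ combs, with associated errant loops having lengths $l_{\mathrm{oe}i}$ and $k_{\mathrm{oe}i}$ combs ($i=1,\ldots,\tilde N_{\mathrm{o}}$); - plain inner cycles (excluding the errant loops) of lengths $L_r$ that contain $K_r$ combs ($r=1,\ldots,N$); - non-plain inner cycles of lengths $\tilde L_r$ that contain $\tilde K_r$ combs, with associated errant loops having lengths $l_{\mathrm{e}r}$ and $k_{\mathrm{e}r}$ combs ($r=1,\ldots,\tilde N$); - plain common circuits of lengths $l_{\mathrm{c}i}$ that contain $k_{\mathrm{c}i}$ combs ($i=1,\ldots,N_{\mathrm{c}}$); - non-plain common circuits of lengths $\tilde l_{\mathrm{c}i}$ that contain $\tilde k_{\mathrm{c}i}$ combs, with associated errant loops having lengths $l_{\mathrm{ce}i}$ and $k_{\mathrm{ce}i}$ combs ($i=1,\ldots,\tilde N_{\mathrm{c}}$); and all non-plain cycles and circuits contain exactly one errant loop node, then the generating function $G(x,y)$ whose coefficient of $x^ny^k$ gives the number of restricted-overlap tilings of an $n$-board with squares and $\mathcal{Q}$-combs that use $k$ combs is $$G(x,y)=\frac{1}{1-A(x,y)-\dfrac{B(x,y)}{D(x,y)}},$$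 where $$A=\sum_{i=1}^{N_{\mathrm{o}}}x^{l_{\mathrm{o}i}}y^{k_{\mathrm{o}i}}+\sum_{i=1}^{\tilde N_{\mathrm{o}}}\frac{x^{\tilde l_{\mathrm{o}i}}y^{\tilde k_{\mathrm{o}i}}}{1-x^{l_{\mathrm{oe}i}}y^{k_{\mathrm{oe}i}}},\qquad B=\sum_{i=1}^{N_{\mathrm{c}}}x^{l_{\mathrm{c}i}}y^{k_{\mathrm{c}i}}+\sum_{i=1}^{\tilde N_{\mathrm{c}}}\frac{x^{\tilde l_{\mathrm{c}i}}y^{\tilde k_{\mathrm{c}i}}}{1-x^{l_{\mathrm{ce}i}}y^{k_{\mathrm{ce}i}}},$$ $$D=1-\sum_{r=1}^{N}x^{L_r}y^{K_r}-\sum_{r=1}^{\tilde N}\frac{x^{\tilde L_r}y^{\tilde K_r}}{1-x^{l_{\mathrm{e}r}}y^{k_{\mathrm{e}r}}}.$$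
   Context: **Combs and tilings.** The $\mathcal{Q}$-comb $C$ is a tile of length $q+1$ with cells labelled $0,\ldots,q$; cell $0$ is filled, and cell $i\in\{1,\ldots,q\}$ is filled iff $i\in\mathcal{Q}$ (the other cells are gaps). An $n$-board is a row of $n$ unit cells. A restricted-overlap tiling of an $n$-board with squares $S$ (unit tiles) and $\mathcal{Q}$-combs is a placement of such tiles within the board covering every cell, in which the only permitted overlaps are between non-leftmost cells (cells $1,\ldots,q$) of different combs. There is one tiling (the empty one) of the $0$-board. A metatile is a gapless grouping of tiles that cannot be split into smaller gapless groupings by removing a gapless grouping of tiles. **Metatile-generating digraph.** This is a directed pseudograph (loops and multiple arcs allowed). One node, the $0$ node, represents the empty board or a completed metatile. Each other node is a bit string, starting with $0$ and ending with $1$, describing the cells of a yet-to-be-completed metatile from its first empty cell to its last filled cell ($0$ = empty, $1$ = filled). Each arc is the addition of one tile so that its leftmost cell is in the first empty cell, and has a length (the increase in the length of the incomplete metatile): - From the $0$ node, an $S$ arc of length $1$ returns to the $0$ node, and a $C$ arc of length $q+1$ goes to the node obtained from the bit string of $C$ (bits for cells $0,\ldots,q$, left to right, with 1 for a filled cell) by deleting all leading 1s. - From a node with string $w$ of $d$ bits, an $S$ arc of length $0$ goes to the node obtained by changing the first bit of $w$ to $1$ and deleting all leading 1s; a $C$ arc of length $q+1-d$ goes to the node obtained by padding $w$ on the right with 0s to $q+1$ bits, taking the bitwise OR with the bit string of $C$, and deleting all leading 1s. If nothing remains after deletion, the node is the $0$ node. The nodes are those reachable from the $0$ node. The length of a walk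 is the sum of the lengths of its arcs, and the number of combs it contains is the number of its $C$ arcs. **Cycles.** A cycle is a closed walk with no repeated node other than the start/end; cycles differing only in the starting node are identified, but parallel arcs are distinguished. An inner cycle is a cycle that does not include the $0$ node. A common node is a node that all the inner cycles have in common. For a digraph lacking a common node, an inner cycle that is a single arc linking a node to itself is called an errant loop if the digraph would only have a common node $\mathcal{P}$ if all the errant loop arcs were removed; the node $\mathcal{P}$ is then called a pseudo-common node. A node with an errant loop is an errant loop node ($\mathcal{P}$ is not one). An outer cycle is a cycle that includes the $0$ node but not $\mathcal{P}$. A common circuit is two concatenated simple paths, from the $0$ node to $\mathcal{P}$ and from $\mathcal{P}$ to the $0$ node. Inner cycles (other than errant loops), outer cycles and common circuits are plain if they do not contain any errant loop nodes and non-plain otherwise. The errant loop associated with a non-plain cycle or circuit is the loop at the errant loop node it contains. *)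

theory Defs
  imports "Graph_Theory.Arc_Walk" "HOL-Computational_Algebra.Formal_Power_Series"
begin

section \<open>Restricted-overlap tilings\<close>

datatype tile = Square | Comb

fun tile_length :: "nat set \<Rightarrow> tile \<Rightarrow> nat" where
  "tile_length Q Square = 1"
| "tile_length Q Comb = Max Q + 1"

text \<open>A placed tile is a tile together with the board position of its leftmost cell; board cells
  are numbered from 0.\<close>

fun filled_cells :: "nat set \<Rightarrow> tile \<times> nat \<Rightarrow> nat set" where
  "filled_cells Q (Square, i) = {i}"
| "filled_cells Q (Comb, i) = {i} \<union> (\<lambda>j. i + j) ` Q"

text \<open>A set of placed tiles suffices: two equal tiles at the same position would overlap in their
  leftmost cells. The gaps of a comb are not filled, so they never cause an overlap.\<close>

definition restricted_overlap_tiling :: "nat set \<Rightarrow> nat \<Rightarrow> (tile \<times> nat) set \<Rightarrow> bool" where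
  "restricted_overlap_tiling Q n T \<longleftrightarrow>
     (\<forall>(t, i) \<in> T. i + tile_length Q t \<le> n) \<and>
     (\<Union>s\<in>T. filled_cells Q s) = {..<n} \<and>
     (\<forall>s\<in>T. \<forall>s'\<in>T. s \<noteq> s' \<longrightarrow>
        (\<forall>c \<in> filled_cells Q s \<inter> filled_cells Q s'.
           fst s = Comb \<and> fst s' = Comb \<and> c \<noteq> snd s \<and> c \<noteq> snd s'))"

definition num_tilings :: "nat set \<Rightarrow> nat \<Rightarrow> nat \<Rightarrow> nat" where
  "num_tilings Q n k =
     card {T. restricted_overlap_tiling Q n T \<and> card {s \<in> T. fst s = Comb} = k}"

section \<open>The metatile-generating digraph\<close>

text \<open>Bit strings are Boolean lists (\<^const>\<open>True\<close> for a filled cell). The empty list is the 0 node.\<close>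

type_synonym node = "bool list"
type_synonym arc = "node \<times> tile"
type_synonym digraph = "(node, arc) pre_digraph"

definition comb_bits :: "nat set \<Rightarrow> bool list" where
  "comb_bits Q = map (\<lambda>i. i = 0 \<or> i \<in> Q) [0..<Max Q + 1]"

definition delete_leading_ones :: "bool list \<Rightarrow> bool list" where
  "delete_leading_ones = dropWhile (\<lambda>b. b)"

fun add_tile :: "nat set \<Rightarrow> node \<Rightarrow> tile \<Rightarrow> node" where
  "add_tile Q [] Square = []"
| "add_tile Q (b # w) Square = delete_leading_ones (True # w)"
| "add_tile Q [] Comb = delete_leading_ones (comb_bits Q)"
| "add_tile Q (b # w) Comb =
     delete_leading_ones
       (map2 (\<or>) ((b # w) @ replicate (Max Q + 1 - length (b # w)) False) (comb_bits Q))"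

fun arc_length :: "nat set \<Rightarrow> arc \<Rightarrow> nat" where
  "arc_length Q ([], Square) = 1"
| "arc_length Q (b # w, Square) = 0"
| "arc_length Q ([], Comb) = Max Q + 1"
| "arc_length Q (b # w, Comb) = Max Q + 1 - length (b # w)"

inductive_set nodes :: "nat set \<Rightarrow> node set" for Q where
  zero: "[] \<in> nodes Q"
| step: "w \<in> nodes Q \<Longrightarrow> add_tile Q w t \<in> nodes Q"

text \<open>An arc is identified by its source and the tile added, so parallel arcs are distinct.\<close>

definition metatile_digraph :: "nat set \<Rightarrow> digraph" where
  "metatile_digraph Q =
     \<lparr>verts = nodes Q, arcs = nodes Q \<times> UNIV, tail = fst, head = (\<lambda>(w, t). add_tile Q w t)\<rparr>"

definition walk_length :: "nat set \<Rightarrow> arc list \<Rightarrow> nat" where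
  "walk_length Q p = sum_list (map (arc_length Q) p)"

definition walk_combs :: "arc list \<Rightarrow> nat" where
  "walk_combs p = length (filter (\<lambda>a. snd a = Comb) p)"

section \<open>Cycles and circuits\<close>

definition rotations :: "'b list \<Rightarrow> 'b list set" where
  "rotations p = {rotate m p |m. True}"

text \<open>Cycles differing only in the starting node are identified by choosing one arc list from each
  class of rotations.\<close>

definition cycles :: "('a, 'b) pre_digraph \<Rightarrow> 'b list set" where
  "cycles G = (\<lambda>p. SOME p'. p' \<in> rotations p) ` {p. pre_digraph.cycle G p}"

text \<open>The nodes visited by a closed walk, with multiplicity, the starting node being listed
  only once.\<close>

definition visits :: "('a, 'b) pre_digraph \<Rightarrow> 'b list \<Rightarrow> 'a list" where
  "visits G p = map (tail G) p"

definition inner_cycles :: "digraph \<Rightarrow> arc list set" where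
  "inner_cycles G = {p \<in> cycles G. [] \<notin> set (visits G p)}"

definition common_node :: "digraph \<Rightarrow> node \<Rightarrow> bool" where
  "common_node G v \<longleftrightarrow>
     v \<in> verts G \<and> v \<noteq> [] \<and> (\<forall>p \<in> inner_cycles G. v \<in> set (visits G p))"

definition remove_arcs :: "('a, 'b) pre_digraph \<Rightarrow> 'b set \<Rightarrow> ('a, 'b) pre_digraph" where
  "remove_arcs G E = G\<lparr>arcs := arcs G - E\<rparr>"

text \<open>The errant loops and the pseudo-common node \<open>P\<close> are defined simultaneously: \<open>E\<close> is the set
  of errant loop arcs with respect to \<open>P\<close>. The last conjunct says that all of them have to be
  removed for \<open>P\<close> to become a common node.\<close>

definition errant_loops_pseudo_common :: "digraph \<Rightarrow> arc set \<Rightarrow> node \<Rightarrow> bool" where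
  "errant_loops_pseudo_common G E P \<longleftrightarrow>
     (\<nexists>v. common_node G v) \<and>
     E \<noteq> {} \<and> (\<forall>a \<in> E. [a] \<in> inner_cycles G) \<and>
     common_node (remove_arcs G E) P \<and>
     (\<forall>E'. E' \<subset> E \<longrightarrow> \<not> common_node (remove_arcs G E') P)"

definition errant_loop_nodes :: "digraph \<Rightarrow> arc set \<Rightarrow> node set" where
  "errant_loop_nodes G E = tail G ` E"

definition non_errant_inner_cycles :: "digraph \<Rightarrow> arc set \<Rightarrow> arc list set" where
  "non_errant_inner_cycles G E = inner_cycles G - {[a] |a. a \<in> E}"

definition outer_cycles :: "digraph \<Rightarrow> node \<Rightarrow> arc list set" where
  "outer_cycles G P = {p \<in> cycles G. [] \<in> set (visits G p) \<and> P \<notin> set (visits G p)}"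

definition common_circuits :: "digraph \<Rightarrow> node \<Rightarrow> arc list set" where
  "common_circuits G P =
     {p\<^sub>1 @ p\<^sub>2 |p\<^sub>1 p\<^sub>2. pre_digraph.apath G [] p\<^sub>1 P \<and> pre_digraph.apath G P p\<^sub>2 []}"

text \<open>An errant loop node that lies on both paths of a common circuit is listed twice: the errant
  loop can be traversed at either visit.\<close>

definition errant_visits :: "digraph \<Rightarrow> arc set \<Rightarrow> arc list \<Rightarrow> node list" where
  "errant_visits G E p = filter (\<lambda>v. v \<in> errant_loop_nodes G E) (visits G p)"

definition plain :: "digraph \<Rightarrow> arc set \<Rightarrow> arc list \<Rightarrow> bool" where
  "plain G E p \<longleftrightarrow> set (visits G p) \<inter> errant_loop_nodes G E = {}"

definition associated_errant_loop :: "digraph \<Rightarrow> arc set \<Rightarrow> arc list \<Rightarrow> arc" where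
  "associated_errant_loop G E p = (THE a. a \<in> E \<and> tail G a \<in> set (visits G p))"

section \<open>Generating functions\<close>

text \<open>Formal power series in \<open>x\<close> and \<open>y\<close> are represented as power series in \<open>x\<close> whose coefficients
  are power series in \<open>y\<close>.\<close>

type_synonym bivariate = "rat fps fps"

definition monomial :: "nat \<Rightarrow> nat \<Rightarrow> bivariate" where
  "monomial l k = fps_X ^ l * fps_const (fps_X ^ k)"

definition walk_monomial :: "nat set \<Rightarrow> arc list \<Rightarrow> bivariate" where
  "walk_monomial Q p = monomial (walk_length Q p) (walk_combs p)"

definition tiling_gf :: "nat set \<Rightarrow> bivariate" where
  "tiling_gf Q = Abs_fps (\<lambda>n. Abs_fps (\<lambda>k. of_nat (num_tilings Q n k)))"

text \<open>Although the coefficient ring is not a field, division by a series with \<open>x\<close>-constant term 1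
  is the true inverse of multiplication.\<close>

lemma bivariate_divide_mult:
  fixes f g :: bivariate
  assumes "fps_nth g 0 = 1"
  shows "f / g * g = f"
proof -
  have s: "subdegree g = 0"
    using assms by (simp add: subdegree_eq_0_iff)
  have "inverse (fps_nth g 0) = 1"
    unfolding assms by (rule fps_inverse_one') simp
  then have "g * inverse g = 1"
    using fps_right_inverse[of g 1] assms by (simp only: fps_inverse_def) simp
  then show ?thesis
    by (simp add: fps_divide_unit'[OF s] mult.assoc mult.commute[of _ g])
qed

end

theory Submission
  imports Defs
begin

text \<open>
  Read a tiling from left to right. The first empty cell can only be covered by a tile that starts
  there, so a tiling is the same as a sequence of tiles, that is, as a closed walk at the 0 node
  with the same length and number of combs (\<open>num_tilings_eq_closed_walks\<close>). The generating
  function is therefore the component \<open>h\<^sub>0\<close> of the solution of the linear system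
  \<open>h\<^sub>v = [v = 0] + (\<Sum>a. x\<^sup>l y\<^sup>k h\<^sub>w)\<close>, where \<open>a\<close> ranges over the arcs leaving \<open>v\<close>, with head \<open>w\<close>,
  length \<open>l\<close> and \<open>k\<close> combs, and \<open>h\<^sub>v\<close> counts the walks from \<open>v\<close> to the 0 node
  (\<open>walks_gf_first_arc\<close>). The system is solved by elimination, which avoids
  infinite sums over walks.

  An errant loop of weight \<open>e\<close> at \<open>v\<close> contributes the term \<open>e h\<^sub>v\<close> to the equation of \<open>v\<close>. Removing it
  multiplies the weights of the other arcs leaving \<open>v\<close> by \<open>1 / (1 - e)\<close> (\<open>walks_gf_loopless\<close>). Once
  the errant loops are gone, every cycle visits the 0 node or \<open>P\<close>. Outside these two nodes the
  digraph is acyclic, and substituting equations along the arcs expresses \<open>h\<^sub>0\<close> and \<open>h\<^sub>P\<close> by each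
  other, with the total weights of the first passages from one of the two nodes to the other or
  back to itself as coefficients (\<open>first_passage_expansion\<close>). First passages repeat no node
  except possibly their ends. Those from 0 to 0 are the outer cycles, those from \<open>P\<close> to \<open>P\<close> the inner
  cycles other than errant loops, and those from 0 to \<open>P\<close> and from \<open>P\<close> to 0 the halves of the common
  circuits. As a non-plain cycle or circuit visits exactly one errant loop node, it carries exactly
  one factor \<open>1 / (1 - e)\<close>, and the coefficients become \<open>A\<close>, \<open>1 - D\<close> and two series \<open>b\<^sub>1\<close> and \<open>b\<^sub>2\<close>
  with \<open>b\<^sub>1 b\<^sub>2 = B\<close>. The remaining system \<open>h\<^sub>0 = 1 + A h\<^sub>0 + b\<^sub>1 h\<^sub>P\<close>, \<open>h\<^sub>P = b\<^sub>2 h\<^sub>0 + (1 - D) h\<^sub>P\<close>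
  yields \<open>h\<^sub>0 = 1 / (1 - A - B / D)\<close> (\<open>tiling_gf_eq_passage_gfs\<close>).
\<close>

section \<open>Placing the leftmost missing tile\<close>

text \<open>A partly tiled board is remembered only through its set \<open>X\<close> of filled cells. The
  leftmost cells of the tiles placed so far need not be recorded: the tiles still to come lie to
  the right of the first empty cell, where all cells of \<open>X\<close> are non-leftmost comb cells and may
  be covered again, except by a leftmost cell.\<close>

definition completions :: "nat set \<Rightarrow> nat set \<Rightarrow> nat \<Rightarrow> nat \<Rightarrow> (tile \<times> nat) set set" where
  "completions Q X n k =
     {T. X \<union> (\<Union>s\<in>T. filled_cells Q s) = {..<n} \<and> (\<forall>s\<in>T. snd s \<notin> X) \<and>
         (\<forall>s\<in>T. \<forall>s'\<in>T. s \<noteq> s' \<longrightarrow>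
            (\<forall>c \<in> filled_cells Q s \<inter> filled_cells Q s'.
               fst s = Comb \<and> fst s' = Comb \<and> c \<noteq> snd s \<and> c \<noteq> snd s')) \<and>
         card {s \<in> T. fst s = Comb} = k}"

lemma filled_cells_ge: "c \<in> filled_cells Q s \<Longrightarrow> snd s \<le> c"
  by (cases s; cases "fst s") auto

lemma leftmost_in_filled_cells: "snd s \<in> filled_cells Q s"
  by (cases s; cases "fst s") auto

lemma filled_cells_Square: "fst s = Square \<Longrightarrow> filled_cells Q s = {snd s}"
  by (cases s; cases "fst s") auto

lemma UNIV_tile: "(UNIV :: tile set) = {Square, Comb}"
  using tile.exhaust by auto

lemma finite_covering:
  assumes "(\<Union>s\<in>T. filled_cells Q s) \<subseteq> {..<n}"
  shows "finite T"
proof (rule finite_subset)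
  show "T \<subseteq> {Square, Comb} \<times> {..<n}"
    using assms leftmost_in_filled_cells UNIV_tile by fastforce
qed simp

lemma finite_completion: "T \<in> completions Q X n k \<Longrightarrow> finite T"
  by (rule finite_covering[of Q _ n]) (auto simp: completions_def)

lemma finite_completions: "finite (completions Q X n k)"
proof (rule finite_subset)
  show "completions Q X n k \<subseteq> Pow (UNIV \<times> {..<n})"
    using leftmost_in_filled_cells by (fastforce simp: completions_def)
qed (simp add: UNIV_tile)

text \<open>The requirement that tiles stay within the board is implied by the covering condition,
  because the last cell of a comb is filled.\<close>

lemma num_tilings_eq_completions:
  assumes "finite Q" "Q \<noteq> {}"
  shows "num_tilings Q n k = card (completions Q {} n k)"
proof -
  have last_cell: "i + tile_length Q t - 1 \<in> filled_cells Q (t, i)" for t i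
    using Max_in[OF assms] by (cases t) auto
  have "i + tile_length Q t \<le> n" if "filled_cells Q (t, i) \<subseteq> {..<n}" for t i
    using last_cell[of i t] that by (cases t) auto
  then have "(\<forall>(t, i)\<in>T. i + tile_length Q t \<le> n)"
    if "(\<Union>s\<in>T. filled_cells Q s) = {..<n}" for T
    using that by blast
  then show ?thesis
    unfolding num_tilings_def restricted_overlap_tiling_def completions_def
    by (intro arg_cong[of _ _ card] Collect_cong) auto
qed

text \<open>The first empty cell \<open>f\<close> has to be covered by a tile whose leftmost cell is \<open>f\<close>: a
  tile starting further left would start in a filled cell. Thus completing a board means choosing
  that tile and completing the enlarged board.\<close>

lemma completions_first_tile:
  assumes f: "{..<f} \<subseteq> X" "f \<notin> X"
  shows "completions Q X n k =
    (if X = {..<n} \<and> k = 0 then {{}} else {}) \<union>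
    (\<Union>t. if of_bool (t = Comb) \<le> k
          then insert (t, f) ` completions Q (X \<union> filled_cells Q (t, f)) n (k - of_bool (t = Comb))
          else {})" (is "_ = ?E \<union> ?U")
proof (intro equalityI subsetI)
  fix T assume T: "T \<in> completions Q X n k"
  note fin = finite_completion[OF T]
  have cover: "X \<union> (\<Union>s\<in>T. filled_cells Q s) = {..<n}" and new: "\<And>s. s \<in> T \<Longrightarrow> snd s \<notin> X"
    and overlap: "\<And>s s' c. s \<in> T \<Longrightarrow> s' \<in> T \<Longrightarrow> s \<noteq> s' \<Longrightarrow> c \<in> filled_cells Q s \<Longrightarrow>
      c \<in> filled_cells Q s' \<Longrightarrow> fst s = Comb \<and> fst s' = Comb \<and> c \<noteq> snd s \<and> c \<noteq> snd s'"
    and combs: "card {s \<in> T. fst s = Comb} = k"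
    using T unfolding completions_def by blast+
  show "T \<in> ?E \<union> ?U"
  proof (cases "X = {..<n}")
    case True
    have "T = {}"
    proof (rule ccontr)
      assume "T \<noteq> {}"
      then obtain s where s: "s \<in> T" by blast
      then have "snd s \<in> X" using cover leftmost_in_filled_cells True by blast
      then show False using new s by blast
    qed
    then show ?thesis using True combs by simp
  next
    case False
    have "f < n"
    proof (rule ccontr)
      assume "\<not> f < n"
      then have "{..<n} \<subseteq> X" using f(1) by (meson lessThan_subset_iff not_less order_trans)
      moreover have "X \<subseteq> {..<n}" unfolding cover[symmetric] by (rule Un_upper1)
      ultimately show False using False by simp
    qed
    then obtain s where s: "s \<in> T" "f \<in> filled_cells Q s" using cover f by blast
    have "snd s = f"
    proof -
      have "\<not> snd s < f" using new[OF s(1)] f by blast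
      then show ?thesis using filled_cells_ge[OF s(2)] by simp
    qed
    then obtain t where st: "s = (t, f)" by (cases s) auto
    define T' where "T' = T - {s}"
    have T_eq: "T = insert s T'" "s \<notin> T'" using s by (auto simp: T'_def)
    have "card {s \<in> T. fst s = Comb} = card {s \<in> T'. fst s = Comb} + of_bool (t = Comb)"
    proof (cases "t = Comb")
      case True
      then have "{s \<in> T. fst s = Comb} = insert s {s \<in> T'. fst s = Comb}"
        using T_eq st by auto
      then show ?thesis using T_eq fin True by simp
    next
      case False
      then have "{s \<in> T. fst s = Comb} = {s \<in> T'. fst s = Comb}"
        using T_eq st by auto
      then show ?thesis using False by simp
    qed
    then have k: "of_bool (t = Comb) \<le> k" "card {s \<in> T'. fst s = Comb} = k - of_bool (t = Comb)"
      using combs by auto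
    have "snd s' \<notin> X \<union> filled_cells Q (t, f)" if "s' \<in> T'" for s'
    proof -
      have "s' \<in> T" "s' \<noteq> s" using that by (auto simp: T'_def)
      then show ?thesis
        using new[of s'] overlap[of s s' "snd s'"] s(1) leftmost_in_filled_cells[of s'] st by auto
    qed
    then have "T' \<in> completions Q (X \<union> filled_cells Q (t, f)) n (k - of_bool (t = Comb))"
      unfolding completions_def mem_Collect_eq
    proof (intro conjI ballI impI)
      show "X \<union> filled_cells Q (t, f) \<union> (\<Union>s\<in>T'. filled_cells Q s) = {..<n}"
        using cover unfolding T_eq(1) st by auto
    next
      fix s1 s2 c assume "s1 \<in> T'" "s2 \<in> T'" "s1 \<noteq> s2"
        "c \<in> filled_cells Q s1 \<inter> filled_cells Q s2"
      then have *: "s1 \<in> T" "s2 \<in> T" "s1 \<noteq> s2" "c \<in> filled_cells Q s1" "c \<in> filled_cells Q s2"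
        using T_eq(1) by auto
      show "fst s1 = Comb" "fst s2 = Comb" "c \<noteq> snd s1" "c \<noteq> snd s2"
        using overlap[OF *] by auto
    qed (use k(2) in auto)
    then have "T \<in> (if of_bool (t = Comb) \<le> k
        then insert (t, f) ` completions Q (X \<union> filled_cells Q (t, f)) n (k - of_bool (t = Comb))
        else {})"
      unfolding if_P[OF k(1)] T_eq(1) st by (rule imageI)
    then show ?thesis by blast
  qed
next
  fix T assume "T \<in> ?E \<union> ?U"
  then show "T \<in> completions Q X n k"
  proof
    assume "T \<in> ?E"
    then show ?thesis by (auto simp: completions_def split: if_splits)
  next
    assume "T \<in> ?U"
    then obtain t where t: "T \<in> (if of_bool (t = Comb) \<le> k
        then insert (t, f) ` completions Q (X \<union> filled_cells Q (t, f)) n (k - of_bool (t = Comb))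
        else {})"
      by blast
    then have k: "of_bool (t = Comb) \<le> k" by (metis empty_iff)
    obtain T' where T: "T = insert (t, f) T'"
      and T': "T' \<in> completions Q (X \<union> filled_cells Q (t, f)) n (k - of_bool (t = Comb))"
      using t unfolding if_P[OF k] by blast
    note fin = finite_completion[OF T']
    have cover: "X \<union> filled_cells Q (t, f) \<union> (\<Union>s\<in>T'. filled_cells Q s) = {..<n}"
      and new: "\<And>s. s \<in> T' \<Longrightarrow> snd s \<notin> X \<and> snd s \<notin> filled_cells Q (t, f)"
      and overlap: "\<And>s s' c. s \<in> T' \<Longrightarrow> s' \<in> T' \<Longrightarrow> s \<noteq> s' \<Longrightarrow> c \<in> filled_cells Q s \<Longrightarrow>
        c \<in> filled_cells Q s' \<Longrightarrow> fst s = Comb \<and> fst s' = Comb \<and> c \<noteq> snd s \<and> c \<noteq> snd s'"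
      and combs: "card {s \<in> T'. fst s = Comb} = k - of_bool (t = Comb)"
      using T' unfolding completions_def by blast+
    have right: "f < snd s" if "s \<in> T'" for s
    proof -
      have "\<not> snd s < f" "snd s \<noteq> f"
        using new[OF that] f leftmost_in_filled_cells[of "(t, f)"] by auto
      then show ?thesis by simp
    qed
    have notin: "(t, f) \<notin> T'" using right by fastforce
    \<comment> \<open>Later tiles start to the right of \<open>f\<close> and outside the new cells, so only non-leftmost
      comb cells can meet the tile at \<open>f\<close>.\<close>
    have pair: "t = Comb \<and> fst s = Comb \<and> c \<noteq> f \<and> c \<noteq> snd s"
      if s: "s \<in> T'" and c: "c \<in> filled_cells Q (t, f)" "c \<in> filled_cells Q s" for s c
    proof -
      have "f < c" using right[OF s] filled_cells_ge[OF c(2)] by simp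
      moreover have "c \<noteq> snd s" using new[OF s] c(1) by blast
      moreover have "t = Comb"
        using filled_cells_Square[of "(t, f)" Q] c(1) \<open>f < c\<close> by (cases t) auto
      moreover have "fst s = Comb"
        using filled_cells_Square[of s Q] c(2) \<open>c \<noteq> snd s\<close> by (cases "fst s") auto
      ultimately show ?thesis by simp
    qed
    have "card {s \<in> T. fst s = Comb} = card {s \<in> T'. fst s = Comb} + of_bool (t = Comb)"
    proof (cases "t = Comb")
      case True
      then have "{s \<in> T. fst s = Comb} = insert (t, f) {s \<in> T'. fst s = Comb}"
        using T by auto
      then show ?thesis using notin fin True by simp
    next
      case False
      then have "{s \<in> T. fst s = Comb} = {s \<in> T'. fst s = Comb}" using T by auto
      then show ?thesis using False by simp
    qed
    then have "card {s \<in> T. fst s = Comb} = k" using combs k by simp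
    moreover have "fst s = Comb \<and> fst s' = Comb \<and> c \<noteq> snd s \<and> c \<noteq> snd s'"
      if ss: "s \<in> T" "s' \<in> T" "s \<noteq> s'" "c \<in> filled_cells Q s" "c \<in> filled_cells Q s'" for s s' c
    proof -
      consider "s = (t, f)" "s' \<in> T'" | "s' = (t, f)" "s \<in> T'" | "s \<in> T'" "s' \<in> T'"
        using ss(1-3) unfolding T by blast
      then show ?thesis
      proof cases
        case 1
        then show ?thesis using pair[of s' c] ss by auto
      next
        case 2
        then show ?thesis using pair[of s c] ss by auto
      next
        case 3
        then show ?thesis using overlap[OF 3 ss(3-5)] by auto
      qed
    qed
    moreover have "X \<union> (\<Union>s\<in>T. filled_cells Q s) = {..<n}"
      using cover unfolding T by auto
    moreover have "\<forall>s\<in>T. snd s \<notin> X" using new f(2) unfolding T by auto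
    ultimately show ?thesis unfolding completions_def by blast
  qed
qed

lemma card_completions_first_tile:
  assumes f: "{..<f} \<subseteq> X" "f \<notin> X"
  shows "card (completions Q X n k) =
    of_bool (X = {..<n} \<and> k = 0) +
    (\<Sum>t\<in>UNIV. if of_bool (t = Comb) \<le> k
          then card (completions Q (X \<union> filled_cells Q (t, f)) n (k - of_bool (t = Comb)))
          else 0)"
proof -
  define S where "S t = (if of_bool (t = Comb) \<le> k
          then insert (t, f) ` completions Q (X \<union> filled_cells Q (t, f)) n (k - of_bool (t = Comb))
          else {})" for t
  have notin: "(t', f) \<notin> T" if "T \<in> completions Q (X \<union> filled_cells Q (t, f)) n k'" for t t' k' T
    using that leftmost_in_filled_cells[of "(t, f)" Q] unfolding completions_def by fastforce
  have fin: "finite (S t)" for t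
    by (simp add: S_def finite_completions)
  have disj: "S t \<inter> S t' = {}" if "t \<noteq> t'" for t t'
    using that notin unfolding S_def by (fastforce split: if_splits)
  have card_S: "card (S t) = (if of_bool (t = Comb) \<le> k
          then card (completions Q (X \<union> filled_cells Q (t, f)) n (k - of_bool (t = Comb)))
          else 0)" for t
  proof -
    have "inj_on (insert (t, f)) (completions Q (X \<union> filled_cells Q (t, f)) n k')" for k'
      by (intro inj_onI) (metis notin insert_ident)
    then show ?thesis by (simp add: S_def card_image)
  qed
  have "card (completions Q X n k) =
    card ((if X = {..<n} \<and> k = 0 then {{}} else {}) \<union> (\<Union>t. S t))"
    using completions_first_tile[OF f, of Q n k] by (simp only: S_def)
  also have "\<dots> = card (if X = {..<n} \<and> k = 0 then {{}} else {} :: (tile \<times> nat) set set) +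
      card (\<Union>t. S t)"
    by (rule card_Un_disjoint) (auto simp: UNIV_tile fin, auto simp: S_def split: if_splits)
  also have "card (\<Union>t. S t) = (\<Sum>t\<in>UNIV. card (S t))"
    by (rule card_UN_disjoint) (use fin disj in \<open>auto simp: UNIV_tile\<close>)
  finally show ?thesis by (simp add: card_S)
qed

section \<open>Tilings as closed walks at the 0 node\<close>

lemma length_add_tile_Comb: "length (add_tile Q w Comb) \<le> Max Q"
proof -
  define m where "m = map (\<lambda>i. i \<in> Q) [1..<Max Q + 1]"
  have m: "comb_bits Q = True # m" "length m = Max Q"
    by (auto simp: comb_bits_def m_def upt_conv_Cons simp del: upt_Suc)
  obtain v where "add_tile Q w Comb = delete_leading_ones (True # v)" "length v \<le> Max Q"
    using m that by (cases w) auto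
  then show ?thesis
    using length_dropWhile_le[of "\<lambda>b. b" v] by (simp add: delete_leading_ones_def)
qed

lemma length_add_tile_Square: "length (add_tile Q w Square) \<le> length w - 1"
  by (cases w) (auto simp: delete_leading_ones_def length_dropWhile_le)

lemma length_node: "w \<in> nodes Q \<Longrightarrow> length w \<le> Max Q"
proof (induction rule: nodes.induct)
  case (step w t)
  then show ?case
    using length_add_tile_Comb[of Q w] length_add_tile_Square[of Q w] by (cases t) auto
qed simp

lemma finite_nodes: "finite (nodes Q)"
  by (rule finite_subset[OF _ finite_lists_length_le[of UNIV "Max Q"]]) (auto simp: length_node)

text \<open>The first empty cell lies the length of the string before the end of the covered part. The
  added tile fills it, so every arc moves it to the right by at least 1.\<close>

lemma length_add_tile:
  assumes "w \<in> nodes Q"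
  shows "length (add_tile Q w t) + 1 \<le> length w + arc_length Q (w, t)"
  using length_add_tile_Comb[of Q w] length_add_tile_Square[of Q w] length_node[OF assms]
  by (cases w; cases t) auto

lemma metatile_digraph_simps [simp]:
  "verts (metatile_digraph Q) = nodes Q"
  "arcs (metatile_digraph Q) = nodes Q \<times> UNIV"
  "tail (metatile_digraph Q) a = fst a"
  "head (metatile_digraph Q) a = add_tile Q (fst a) (snd a)"
  by (auto simp: metatile_digraph_def split: prod.split)

interpretation metatile: fin_digraph "metatile_digraph Q" for Q
  by unfold_locales (auto simp: finite_nodes UNIV_tile intro: nodes.step)

lemma walk_length_simps [simp]:
  "walk_length Q [] = 0" "walk_length Q (a # p) = arc_length Q a + walk_length Q p"
  by (simp_all add: walk_length_def)

lemma walk_combs_simps [simp]: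
  "walk_combs [] = 0" "walk_combs (a # p) = of_bool (snd a = Comb) + walk_combs p"
  by (simp_all add: walk_combs_def)

text \<open>Arcs may have length 0, so finiteness of the set of walks of a given length, and
  positivity of the length of closed walks, are not immediate; both follow from this bound.\<close>

lemma length_le_walk_length:
  assumes "pre_digraph.awalk (metatile_digraph Q) w p w'"
  shows "length w' + length p \<le> length w + walk_length Q p"
  using assms
proof (induction p arbitrary: w)
  case (Cons a p)
  obtain t where "a = (w, t)" "w \<in> nodes Q"
    "pre_digraph.awalk (metatile_digraph Q) (add_tile Q w t) p w'"
    using Cons.prems by (cases a) (auto simp: metatile.awalk_Cons_iff)
  then show ?case
    using length_add_tile[of w Q t] Cons.IH[of "add_tile Q w t"] by simp
qed (auto simp: metatile.awalk_Nil_iff)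

lemma closed_walk_length_pos:
  assumes "pre_digraph.awalk (metatile_digraph Q) w p w" "p \<noteq> []"
  shows "0 < walk_length Q p"
  using length_le_walk_length[OF assms(1)] assms(2) by (cases p) auto

definition walks_to_zero :: "nat set \<Rightarrow> node \<Rightarrow> nat \<Rightarrow> nat \<Rightarrow> arc list set" where
  "walks_to_zero Q w l k =
     {p. pre_digraph.awalk (metatile_digraph Q) w p [] \<and> walk_length Q p = l \<and> walk_combs p = k}"

lemma finite_walks_to_zero: "finite (walks_to_zero Q w l k)"
proof (rule finite_subset)
  show "walks_to_zero Q w l k \<subseteq> {p. set p \<subseteq> nodes Q \<times> UNIV \<and> length p \<le> length w + l}"
    using length_le_walk_length[of Q w _ "[]"]
    by (fastforce simp: walks_to_zero_def metatile.awalk_def)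
  show "finite {p. set p \<subseteq> nodes Q \<times> (UNIV :: tile set) \<and> length p \<le> length w + l}"
    by (rule finite_lists_length_le) (simp add: finite_nodes UNIV_tile)
qed

lemma card_walks_to_zero_first_arc:
  assumes "w \<in> nodes Q"
  shows "card (walks_to_zero Q w l k) = of_bool (w = [] \<and> l = 0 \<and> k = 0) +
    (\<Sum>t\<in>UNIV. if arc_length Q (w, t) \<le> l \<and> of_bool (t = Comb) \<le> k
       then card (walks_to_zero Q (add_tile Q w t) (l - arc_length Q (w, t)) (k - of_bool (t = Comb)))
       else 0)"
proof -
  define S where "S t = (if arc_length Q (w, t) \<le> l \<and> of_bool (t = Comb) \<le> k
       then (#) (w, t) `
         walks_to_zero Q (add_tile Q w t) (l - arc_length Q (w, t)) (k - of_bool (t = Comb))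
       else {})" for t
  define Z where "Z = (if w = [] \<and> l = 0 \<and> k = 0 then {[]} else {} :: arc list set)"
  have "p \<in> walks_to_zero Q w l k \<longleftrightarrow> p \<in> Z \<union> (\<Union>t. S t)" for p
  proof (cases p)
    case Nil
    then show ?thesis
      using assms by (auto simp: walks_to_zero_def Z_def S_def metatile.awalk_Nil_iff split: if_splits)
  next
    case (Cons a p')
    obtain v t where a: "a = (v, t)" by (cases a)
    show ?thesis
    proof (cases "v = w")
      case True
      have "p \<in> Z \<union> (\<Union>t. S t) \<longleftrightarrow> p \<in> S t"
        unfolding Cons a True by (auto simp: Z_def S_def split: if_splits)
      also have "\<dots> \<longleftrightarrow> p \<in> walks_to_zero Q w l k"
        using assms unfolding Cons a True S_def walks_to_zero_def
        by (auto simp: metatile.awalk_Cons_iff)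
      finally show ?thesis by simp
    next
      case False
      then have "p \<notin> Z \<union> (\<Union>t. S t)"
        unfolding Cons a by (auto simp: Z_def S_def split: if_splits)
      moreover have "p \<notin> walks_to_zero Q w l k"
        using False unfolding Cons a walks_to_zero_def by (auto simp: metatile.awalk_Cons_iff)
      ultimately show ?thesis by blast
    qed
  qed
  then have "walks_to_zero Q w l k = Z \<union> (\<Union>t. S t)" by blast
  moreover have fin: "finite (S t)" for t
    by (simp add: S_def finite_walks_to_zero)
  ultimately have "card (walks_to_zero Q w l k) = card Z + card (\<Union>t. S t)"
    by (simp only:, intro card_Un_disjoint)
      (auto simp: Z_def UNIV_tile, auto simp: S_def split: if_splits)
  also have "card (\<Union>t. S t) = (\<Sum>t\<in>UNIV. card (S t))"
  proof (rule card_UN_disjoint)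
    show "\<forall>t\<in>UNIV. \<forall>t'\<in>UNIV. t \<noteq> t' \<longrightarrow> S t \<inter> S t' = {}"
      by (auto simp: S_def)
  qed (use fin in \<open>auto simp: UNIV_tile\<close>)
  finally have "card (walks_to_zero Q w l k) = card Z + (\<Sum>t\<in>UNIV. card (S t))" .
  moreover have "card (S t) = (if arc_length Q (w, t) \<le> l \<and> of_bool (t = Comb) \<le> k
       then card (walks_to_zero Q (add_tile Q w t) (l - arc_length Q (w, t)) (k - of_bool (t = Comb)))
       else 0)" for t
    by (simp add: S_def card_image)
  ultimately show ?thesis by (simp add: Z_def)
qed

text \<open>The dictionary between boards and nodes: cells before \<open>f\<close> are filled, the node \<open>w\<close>
  describes the cells from \<open>f\<close> on, and its last bit is 1, so that \<open>f + length w\<close> is the length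
  covered so far.\<close>

definition board_state :: "nat set \<Rightarrow> nat \<Rightarrow> node \<Rightarrow> bool" where
  "board_state X f w \<longleftrightarrow>
     {..<f} \<subseteq> X \<and> X \<subseteq> {..<f + length w} \<and> (\<forall>j < length w. w ! j \<longleftrightarrow> f + j \<in> X) \<and>
     (w \<noteq> [] \<longrightarrow> \<not> w ! 0 \<and> w ! (length w - 1))"

lemma board_state_first_empty: "board_state X f w \<Longrightarrow> f \<notin> X"
  by (cases w) (auto simp: board_state_def)

text \<open>Deleting leading ones moves the first empty cell to the right without changing the board.\<close>

lemma board_state_delete_leading_ones:
  assumes "{..<f} \<subseteq> X" "X \<subseteq> {..<f + length v}" "\<forall>j < length v. v ! j \<longleftrightarrow> f + j \<in> X"
    and "v \<noteq> [] \<Longrightarrow> v ! (length v - 1)"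
  shows "\<exists>f' \<ge> f. f' + length (delete_leading_ones v) = f + length v \<and>
    board_state X f' (delete_leading_ones v)"
  using assms
proof (induction v arbitrary: f)
  case Nil
  then show ?case by (auto simp: delete_leading_ones_def board_state_def)
next
  case (Cons b v)
  show ?case
  proof (cases b)
    case True
    have "f \<in> X" using Cons.prems(3) True by force
    then have "{..<Suc f} \<subseteq> X" using Cons.prems(1) by (auto simp: less_Suc_eq)
    moreover have "X \<subseteq> {..<Suc f + length v}" using Cons.prems(2) by simp
    moreover have "\<forall>j < length v. v ! j \<longleftrightarrow> Suc f + j \<in> X"
      using Cons.prems(3) by force
    moreover have "v \<noteq> [] \<Longrightarrow> v ! (length v - 1)" using Cons.prems(4) by (cases v) auto
    ultimately have "\<exists>f' \<ge> Suc f. f' + length (delete_leading_ones v) = Suc f + length v \<and>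
        board_state X f' (delete_leading_ones v)"
      by (rule Cons.IH)
    then show ?thesis using True by (auto simp: delete_leading_ones_def intro: Suc_leD)
  next
    case False
    then have "delete_leading_ones (b # v) = b # v" by (simp add: delete_leading_ones_def)
    then show ?thesis using Cons.prems False by (auto simp: board_state_def)
  qed
qed

lemma add_tile_Comb_eq:
  assumes "length w \<le> Max Q + 1"
  shows "add_tile Q w Comb = delete_leading_ones
    (map (\<lambda>i. (i < length w \<and> w ! i) \<or> i = 0 \<or> i \<in> Q) [0..<Max Q + 1])"
proof (cases w)
  case Nil
  then show ?thesis by (simp add: comb_bits_def)
next
  case (Cons b w')
  have "map2 (\<or>) (w @ replicate (Max Q + 1 - length w) False) (comb_bits Q) =
      map (\<lambda>i. (i < length w \<and> w ! i) \<or> i = 0 \<or> i \<in> Q) [0..<Max Q + 1]"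
    by (rule nth_equalityI) (use assms in \<open>auto simp: comb_bits_def nth_append simp del: upt_Suc\<close>)
  then show ?thesis using Cons by (simp del: upt_Suc)
qed

text \<open>Following an arc of the digraph is the same as placing the tile in the first empty cell.\<close>

lemma board_state_add_tile:
  assumes Q: "finite Q" "Q \<noteq> {}" "\<forall>j\<in>Q. 0 < j"
    and w: "w \<in> nodes Q" and state: "board_state X f w"
  shows "\<exists>f' > f. f' + length (add_tile Q w t) = f + length w + arc_length Q (w, t) \<and>
    board_state (X \<union> filled_cells Q (t, f)) f' (add_tile Q w t)"
proof -
  let ?X = "X \<union> filled_cells Q (t, f)"
  have len: "length w \<le> Max Q" using length_node[OF w] .
  have MaxQ: "Max Q \<in> Q" "0 < Max Q" "\<And>j. j \<in> Q \<Longrightarrow> j \<le> Max Q"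
    using Q Max_in[of Q] by auto
  \<comment> \<open>The bit string after adding the tile and before deleting leading ones.\<close>
  define v where "v = (if t = Square then True # tl w
    else map (\<lambda>i. (i < length w \<and> w ! i) \<or> i = 0 \<or> i \<in> Q) [0..<Max Q + 1])"
  have v: "add_tile Q w t = delete_leading_ones v"
  proof (cases t)
    case Square
    then show ?thesis by (cases w) (auto simp: v_def delete_leading_ones_def)
  next
    case Comb
    then show ?thesis using add_tile_Comb_eq[of w Q] len by (simp add: v_def del: upt_Suc)
  qed
  have length_v: "f + length v = f + length w + arc_length Q (w, t)"
    using len by (cases w; cases t) (auto simp: v_def)
  have X: "{..<f} \<subseteq> X" "X \<subseteq> {..<f + length w}" "\<And>j. j < length w \<Longrightarrow> w ! j \<longleftrightarrow> f + j \<in> X"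
    "w \<noteq> [] \<Longrightarrow> w ! (length w - 1)"
    using state by (auto simp: board_state_def)
  have nth_v: "v ! j \<longleftrightarrow> f + j \<in> ?X" if j: "j < length v" for j
  proof (cases t)
    case Square
    then show ?thesis using X(3)[of j] j by (cases w; cases j) (auto simp: v_def)
  next
    case Comb
    have "f + j \<in> X \<longleftrightarrow> j < length w \<and> w ! j" using X(2) X(3)[of j] by auto
    then show ?thesis using Comb j by (auto simp: v_def add.commute simp del: upt_Suc)
  qed
  have sub: "?X \<subseteq> {..<f + length v}"
  proof (cases t)
    case Square
    then show ?thesis using X(2) by (cases w) (auto simp: v_def)
  next
    case Comb
    then show ?thesis using X(2) len MaxQ(3) by (fastforce simp: v_def less_Suc_eq_le)
  qed
  have last: "v ! (length v - 1)"
  proof (cases t)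
    case Square
    then show ?thesis using X(4) by (cases w) (auto simp: v_def nth_Cons split: nat.splits)
  next
    case Comb
    then show ?thesis using MaxQ by (simp add: v_def del: upt_Suc)
  qed
  obtain f' where f': "f' \<ge> f" "f' + length (add_tile Q w t) = f + length v"
    "board_state ?X f' (add_tile Q w t)"
    using board_state_delete_leading_ones[of f ?X v] X(1) sub nth_v last unfolding v by blast
  moreover have "f' \<noteq> f"
    using board_state_first_empty[OF f'(3)] leftmost_in_filled_cells[of "(t, f)" Q] by auto
  ultimately show ?thesis using length_v by (intro exI[of _ f']) auto
qed

lemma board_state_full_iff:
  assumes "board_state X f w" "f + length w \<le> n"
  shows "X = {..<n} \<longleftrightarrow> w = [] \<and> f + length w = n"
proof
  assume X: "X = {..<n}"
  have "f \<notin> X" using board_state_first_empty[OF assms(1)] .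
  then show "w = [] \<and> f + length w = n" using assms(2) X by (cases w) auto
next
  assume "w = [] \<and> f + length w = n"
  then show "X = {..<n}" using assms(1) by (auto simp: board_state_def)
qed

text \<open>A comb sticking out over the end of the board cannot be part of a tiling. The corresponding
  walk is already longer than the board.\<close>

lemma completions_overfull:
  assumes "board_state X f w" "n < f + length w"
  shows "completions Q X n k = {}"
proof -
  have "f + length w - 1 \<in> X"
  proof (cases w)
    case Nil
    then show ?thesis using assms by (auto simp: board_state_def)
  next
    case (Cons b w')
    then have "w ! (length w - 1)" "length w - 1 < length w"
      using assms(1) by (auto simp: board_state_def)
    then have "f + (length w - 1) \<in> X"
      using assms(1) unfolding board_state_def by blast
    then show ?thesis using Cons by simp
  qed
  moreover have "f + length w - 1 \<notin> {..<n}" using assms(2) by auto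
  ultimately show ?thesis by (auto simp: completions_def)
qed

text \<open>Both sides satisfy the same recursion, by the choice of the next tile and of the next arc.
  It is well founded because every tile advances the first empty cell.\<close>

lemma card_completions_eq_walks:
  assumes Q: "finite Q" "Q \<noteq> {}" "\<forall>j\<in>Q. 0 < j"
  shows "w \<in> nodes Q \<Longrightarrow> board_state X f w \<Longrightarrow> f + length w \<le> n \<Longrightarrow>
    card (completions Q X n k) = card (walks_to_zero Q w (n - (f + length w)) k)"
proof (induction "n - f" arbitrary: X f w k rule: less_induct)
  case less
  let ?l = "n - (f + length w)"
  have "(if of_bool (t = Comb) \<le> k
          then card (completions Q (X \<union> filled_cells Q (t, f)) n (k - of_bool (t = Comb))) else 0) =
     (if arc_length Q (w, t) \<le> ?l \<and> of_bool (t = Comb) \<le> k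
       then card (walks_to_zero Q (add_tile Q w t) (?l - arc_length Q (w, t)) (k - of_bool (t = Comb)))
       else 0)" for t
  proof -
    obtain f' where f': "f < f'" "f' + length (add_tile Q w t) = f + length w + arc_length Q (w, t)"
      "board_state (X \<union> filled_cells Q (t, f)) f' (add_tile Q w t)"
      using board_state_add_tile[OF Q less.prems(1,2)] by blast
    show ?thesis
    proof (cases "f' + length (add_tile Q w t) \<le> n")
      case True
      have "n - f' < n - f" using True f'(1) by simp
      from less.hyps[OF this nodes.step[OF less.prems(1)] f'(3) True]
      have "card (completions Q (X \<union> filled_cells Q (t, f)) n j) =
          card (walks_to_zero Q (add_tile Q w t) (?l - arc_length Q (w, t)) j)" for j
        by (simp add: f'(2) diff_diff_left)
      moreover have "arc_length Q (w, t) \<le> ?l" using True f'(2) by simp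
      ultimately show ?thesis by simp
    next
      case False
      then have "\<not> arc_length Q (w, t) \<le> ?l" using f'(2) less.prems(3) by simp
      then show ?thesis using completions_overfull[OF f'(3), of n Q] False by simp
    qed
  qed
  moreover have "X = {..<n} \<longleftrightarrow> w = [] \<and> ?l = 0"
    using board_state_full_iff[OF less.prems(2,3)] less.prems(3) by auto
  ultimately show ?case
    using card_completions_first_tile[of f X Q n k] card_walks_to_zero_first_arc[OF less.prems(1)]
      board_state_first_empty[OF less.prems(2)] less.prems(2)
    by (auto simp: board_state_def)
qed

theorem num_tilings_eq_closed_walks:
  assumes Q: "finite Q" "Q \<noteq> {}" "\<forall>j\<in>Q. 0 < j"
  shows "num_tilings Q n k = card (walks_to_zero Q [] n k)"
  using card_completions_eq_walks[OF Q nodes.zero, of "{}" 0 n k]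
  by (simp add: num_tilings_eq_completions[OF Q(1,2)] board_state_def)

section \<open>The linear system for the walk generating functions\<close>

definition walks_gf :: "nat set \<Rightarrow> node \<Rightarrow> bivariate" where
  "walks_gf Q w = Abs_fps (\<lambda>l. Abs_fps (\<lambda>k. of_nat (card (walks_to_zero Q w l k))))"

lemma monomial_mult: "monomial l k * monomial l' k' = monomial (l + l') (k + k')"
  by (simp add: monomial_def power_add mult_ac flip: fps_const_mult)

lemma nth_monomial_mult:
  "fps_nth (fps_nth (monomial l k * H) n) j =
     (if l \<le> n \<and> k \<le> j then fps_nth (fps_nth H (n - l)) (j - k) else 0)"
  by (auto simp: monomial_def mult.assoc fps_X_power_mult_nth)

lemma walk_monomial_Nil [simp]: "walk_monomial Q [] = 1"
  by (simp add: walk_monomial_def monomial_def)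

lemma walk_monomial_Cons: "walk_monomial Q (a # p) = walk_monomial Q [a] * walk_monomial Q p"
  by (simp add: walk_monomial_def monomial_mult)

lemma walk_monomial_nth_0: "0 < walk_length Q p \<Longrightarrow> fps_nth (walk_monomial Q p) 0 = 0"
  by (simp add: walk_monomial_def monomial_def)

lemma out_arcs_metatile:
  "w \<in> nodes Q \<Longrightarrow> out_arcs (metatile_digraph Q) w = Pair w ` UNIV"
  by (auto simp: out_arcs_def)

lemma one_divide_mult_self:
  fixes g :: bivariate
  assumes "fps_nth g 0 = 1"
  shows "1 / g * g = 1"
  using bivariate_divide_mult[OF assms, of 1] .

text \<open>Over a coefficient ring that is not a field, division is multiplication by an inverse only
  for suitable denominators.\<close>

lemma divide_eq_mult_inverse:
  fixes f g :: bivariate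
  assumes "fps_nth g 0 = 1"
  shows "f / g = f * (1 / g)"
proof -
  have "(f / g) * g = (f * (1 / g)) * g"
    using bivariate_divide_mult[OF assms] by (simp add: mult.assoc)
  moreover have "g \<noteq> 0" using assms by auto
  ultimately show ?thesis by simp
qed

text \<open>Splitting a walk at its first arc turns the digraph into a linear system with one unknown
  series per node.\<close>

lemma walks_gf_first_arc:
  assumes "w \<in> nodes Q"
  shows "walks_gf Q w = of_bool (w = []) +
    (\<Sum>a \<in> out_arcs (metatile_digraph Q) w.
       walk_monomial Q [a] * walks_gf Q (head (metatile_digraph Q) a))"
proof -
  have "walks_gf Q w = of_bool (w = []) +
    (\<Sum>t\<in>UNIV. walk_monomial Q [(w, t)] * walks_gf Q (add_tile Q w t))"
  proof (rule fps_ext, rule fps_ext)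
    fix l k
    have "fps_nth (fps_nth (of_bool (w = []) :: bivariate) l) k = of_bool (w = [] \<and> l = 0 \<and> k = 0)"
      by simp
    moreover have "fps_nth (fps_nth (walk_monomial Q [(w, t)] * walks_gf Q (add_tile Q w t)) l) k =
      (if arc_length Q (w, t) \<le> l \<and> of_bool (t = Comb) \<le> k
       then of_nat (card (walks_to_zero Q (add_tile Q w t) (l - arc_length Q (w, t)) (k - of_bool (t = Comb))))
       else 0)" for t
      unfolding walk_monomial_def nth_monomial_mult walks_gf_def by simp
    ultimately show "fps_nth (fps_nth (walks_gf Q w) l) k = fps_nth (fps_nth (of_bool (w = []) +
        (\<Sum>t\<in>UNIV. walk_monomial Q [(w, t)] * walks_gf Q (add_tile Q w t))) l) k"
      by (simp add: fps_sum_nth walks_gf_def card_walks_to_zero_first_arc[OF assms] of_nat_sum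
        if_distrib[of of_nat] cong: if_cong)
  qed
  also have "(\<Sum>t\<in>UNIV. walk_monomial Q [(w, t)] * walks_gf Q (add_tile Q w t)) =
    (\<Sum>a \<in> out_arcs (metatile_digraph Q) w.
       walk_monomial Q [a] * walks_gf Q (head (metatile_digraph Q) a))"
    unfolding out_arcs_metatile[OF assms] by (subst sum.reindex) (auto simp: inj_on_def)
  finally show ?thesis .
qed

section \<open>Cycles up to rotation\<close>

lemma (in pre_digraph) awalk_verts_eq_tails:
  "cas u p v \<Longrightarrow> awalk_verts u p = map (tail G) p @ [v]"
  by (induction p arbitrary: u) auto

lemma self_in_rotations: "p \<in> rotations p"
  unfolding rotations_def by (metis (mono_tags) mem_Collect_eq rotate0 id_apply)

lemma rotations_eq:
  assumes "p' \<in> rotations p"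
  shows "rotations p' = rotations p"
proof -
  have sub: "rotations (rotate m p) \<subseteq> rotations p" for m and p :: "'b list"
    by (auto simp: rotations_def rotate_rotate)
  obtain m where m: "p' = rotate m p" using assms by (auto simp: rotations_def)
  have "p = rotate (length p - m mod length p) p'"
  proof (cases "p = []")
    case False
    then have "m mod length p \<le> length p" by (simp add: less_imp_le)
    then have "rotate (length p - m mod length p) (rotate (m mod length p) p) = p"
      by (simp add: rotate_rotate)
    then show ?thesis unfolding m by (simp flip: rotate_conv_mod)
  qed (simp add: m)
  then show ?thesis using sub m by (metis subset_antisym)
qed

text \<open>The choice depends on the class of rotations only, so a cycle has the same representative in
  a digraph and in its subgraphs.\<close>

definition cycle_representative :: "'b list \<Rightarrow> 'b list" where
  "cycle_representative p = (SOME p'. p' \<in> rotations p)"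

lemma cycle_representative_in: "cycle_representative p \<in> rotations p"
  unfolding cycle_representative_def by (rule someI[of _ p]) (rule self_in_rotations)

lemma cycle_representative_eq_iff:
  "cycle_representative p = cycle_representative p' \<longleftrightarrow> p' \<in> rotations p"
proof
  assume "cycle_representative p = cycle_representative p'"
  then have "rotations p = rotations p'"
    using rotations_eq[OF cycle_representative_in[of p]]
      rotations_eq[OF cycle_representative_in[of p']] by simp
  then show "p' \<in> rotations p" using self_in_rotations[of p'] by simp
next
  assume "p' \<in> rotations p"
  from rotations_eq[OF this] show "cycle_representative p = cycle_representative p'"
    by (simp add: cycle_representative_def)
qed

lemma set_cycle_representative [simp]: "set (cycle_representative p) = set p"
  using cycle_representative_in[of p] by (auto simp: rotations_def)

lemma cycles_conv: "cycles G = cycle_representative ` {p. pre_digraph.cycle G p}"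
  by (simp add: cycles_def cycle_representative_def[abs_def])

context wf_digraph
begin

lemma cycle_iff:
  "cycle p \<longleftrightarrow>
     p \<noteq> [] \<and> distinct (map (tail G) p) \<and> awalk (tail G (hd p)) p (tail G (hd p))"
proof -
  have "distinct (tl (awalk_verts u p)) \<longleftrightarrow> distinct (map (tail G) p)" and "u = tail G (hd p)"
    if "awalk u p u" "p \<noteq> []" for u
  proof -
    show "u = tail G (hd p)" using that by (cases p) (auto simp: awalk_Cons_iff)
    then show "distinct (tl (awalk_verts u p)) \<longleftrightarrow> distinct (map (tail G) p)"
      using that awalk_verts_eq_tails[of u p u] by (cases p) (auto simp: awalk_def)
  qed
  then show ?thesis unfolding cycle_def by metis
qed

lemma cycle_rotate: "cycle p \<Longrightarrow> cycle (rotate m p)"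
proof (induction m)
  case (Suc m)
  then obtain a q where aq: "rotate m p = a # q" "cycle (a # q)"
    by (cases "rotate m p") (auto simp: cycle_iff)
  then have "awalk (head G a) q (tail G a)" "awalk (tail G a) [a] (head G a)"
    by (auto simp: cycle_iff awalk_simps)
  then have "awalk (head G a) (q @ [a]) (head G a)" by (rule awalk_appendI)
  moreover from this have "tail G (hd (q @ [a])) = head G a"
    by (cases q) (auto simp: awalk_Cons_iff)
  ultimately have "cycle (q @ [a])" using aq(2) by (auto simp: cycle_iff)
  then show ?case by (simp add: aq(1))
qed simp

lemma cycle_if_in_cycles: "p \<in> cycles G \<Longrightarrow> cycle p"
proof -
  assume "p \<in> cycles G"
  then obtain c where c: "cycle c" "p = cycle_representative c" by (auto simp: cycles_conv)
  then obtain m where "p = rotate m c"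
    using cycle_representative_in[of c] by (auto simp: rotations_def)
  then show ?thesis using cycle_rotate c by blast
qed

text \<open>A loop leads back to its tail at once, so a cycle that traverses a loop has to stop there.\<close>

lemma cycle_through_loop:
  assumes "cycle p" "a \<in> set p" "head G a = tail G a"
  shows "p = [a]"
proof -
  obtain m where m: "m < length p" "a = p ! m" using assms(2) by (auto simp: in_set_conv_nth)
  then have "hd (rotate m p) = a" using hd_rotate_conv_nth[of p m] by (cases p) auto
  moreover have c: "cycle (rotate m p)" using assms(1) by (rule cycle_rotate)
  ultimately obtain q where q: "rotate m p = a # q" by (cases "rotate m p") (auto simp: cycle_iff)
  have "q = []"
  proof (cases q)
    case (Cons b q')
    then have "tail G b = head G a" using c q by (auto simp: cycle_iff awalk_Cons_iff)
    then show ?thesis using c q Cons assms(3) by (auto simp: cycle_iff)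
  qed
  then have "length p = 1" using q by (metis length_rotate length_Cons list.size(3) One_nat_def)
  then show ?thesis using m by (cases p) auto
qed

text \<open>A cycle visits \<open>v\<close> at most once, so among its rotations exactly one starts at \<open>v\<close>. This
  replaces arbitrarily chosen representatives by cycles based at \<open>v\<close>.\<close>

lemma bij_betw_cycles_through:
  "bij_betw cycle_representative
     {p. p \<noteq> [] \<and> awalk v p v \<and> distinct (map (tail G) p) \<and> R (tail G ` set p)}
     {p \<in> cycles G. v \<in> set (visits G p) \<and> R (set (visits G p))}"
  (is "bij_betw _ ?L ?R")
proof (rule bij_betw_imageI)
  have L: "cycle p \<and> tail G (hd p) = v" if "p \<in> ?L" for p
    using that by (cases p) (auto simp: cycle_iff awalk_Cons_iff)
  show "inj_on cycle_representative ?L"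
  proof (rule inj_onI)
    fix p p' assume p: "p \<in> ?L" "p' \<in> ?L" and eq: "cycle_representative p = cycle_representative p'"
    then obtain m where m: "p' = rotate m p"
      by (auto simp: cycle_representative_eq_iff rotations_def)
    have ne: "p \<noteq> []" using p by simp
    have "hd p' = p ! (m mod length p)" unfolding m using ne by (rule hd_rotate_conv_nth)
    then have "map (tail G) p ! (m mod length p) = map (tail G) p ! 0"
      using L[OF p(1)] L[OF p(2)] ne by (simp add: hd_conv_nth)
    moreover have "distinct (map (tail G) p)" using p by simp
    ultimately have "m mod length p = 0"
      using ne by (subst (asm) nth_eq_iff_index_eq) auto
    then show "p = p'" unfolding m by (metis rotate_conv_mod rotate0 id_apply)
  qed
  show "cycle_representative ` ?L = ?R"
  proof (intro equalityI subsetI)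
    fix r assume "r \<in> cycle_representative ` ?L"
    then obtain p where p: "p \<in> ?L" "r = cycle_representative p" by blast
    moreover have "hd p \<in> set p" using p by simp
    ultimately show "r \<in> ?R"
      using L[OF p(1)] by (auto simp: cycles_conv visits_def)
  next
    fix r assume r: "r \<in> ?R"
    then obtain c where c: "cycle c" "r = cycle_representative c" by (auto simp: cycles_conv)
    have "v \<in> tail G ` set c" using r c by (simp add: visits_def)
    then obtain m where m: "m < length c" "v = tail G (c ! m)" by (auto simp: in_set_conv_nth)
    define p where "p = rotate m c"
    have "cycle p" using cycle_rotate c p_def by blast
    moreover have "hd p = c ! m"
      using hd_rotate_conv_nth[of c m] m unfolding p_def by (cases c) auto
    moreover have "set p = set c" by (simp add: p_def)
    ultimately have "p \<in> ?L" using r c m by (auto simp: cycle_iff visits_def)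
    moreover have "r = cycle_representative p"
      using c by (auto simp: cycle_representative_eq_iff p_def rotations_def)
    ultimately show "r \<in> cycle_representative ` ?L" by blast
  qed
qed

lemma sum_cycles_through:
  assumes "\<And>m p. f (rotate m p) = f p"
  shows "(\<Sum>p \<in> {p \<in> cycles G. v \<in> set (visits G p) \<and> R (set (visits G p))}. f p) =
    (\<Sum>p \<in> {p. p \<noteq> [] \<and> awalk v p v \<and> distinct (map (tail G) p) \<and> R (tail G ` set p)}. f p)"
proof -
  have "f (cycle_representative p) = f p" for p
    using cycle_representative_in[of p] assms by (auto simp: rotations_def)
  then show ?thesis
    using sum.reindex_bij_betw[OF bij_betw_cycles_through[of v R], of f] by simp
qed

end

section \<open>Deleting arcs\<close>

lemma cas_arcs_update [simp]: "pre_digraph.cas (G\<lparr>arcs := A\<rparr>) u p v = pre_digraph.cas G u p v"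
  by (induction p arbitrary: u) (auto simp: pre_digraph.cas.simps)

lemma awalk_verts_arcs_update [simp]:
  "pre_digraph.awalk_verts (G\<lparr>arcs := A\<rparr>) u p = pre_digraph.awalk_verts G u p"
  by (induction p arbitrary: u) (auto simp: pre_digraph.awalk_verts.simps)

lemma (in pre_digraph) awalk_arcs_update:
  assumes "A \<subseteq> arcs G"
  shows "pre_digraph.awalk (G\<lparr>arcs := A\<rparr>) u p v \<longleftrightarrow> awalk u p v \<and> set p \<subseteq> A"
  using assms by (auto simp: pre_digraph.awalk_def)

lemma (in pre_digraph) cycle_arcs_update:
  assumes "A \<subseteq> arcs G"
  shows "pre_digraph.cycle (G\<lparr>arcs := A\<rparr>) p \<longleftrightarrow> cycle p \<and> set p \<subseteq> A"
  by (auto simp: pre_digraph.cycle_def awalk_arcs_update[OF assms])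

lemma (in pre_digraph) awalk_remove_arcs:
  "pre_digraph.awalk (remove_arcs G F) u p v \<longleftrightarrow> awalk u p v \<and> set p \<inter> F = {}"
  unfolding remove_arcs_def by (subst awalk_arcs_update) (auto simp: awalk_def)

lemma (in pre_digraph) cycles_remove_arcs:
  "cycles (remove_arcs G F) = {p \<in> cycles G. set p \<inter> F = {}}"
proof -
  have cyc: "pre_digraph.cycle (remove_arcs G F) p \<longleftrightarrow> cycle p \<and> set p \<inter> F = {}" for p
    unfolding remove_arcs_def by (subst cycle_arcs_update) (auto simp: cycle_def awalk_def)
  show ?thesis unfolding cycles_conv by (auto simp: cyc)
qed

lemma remove_arcs_simps [simp]:
  "verts (remove_arcs G F) = verts G" "arcs (remove_arcs G F) = arcs G - F"
  "tail (remove_arcs G F) = tail G" "head (remove_arcs G F) = head G"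
  "visits (remove_arcs G F) = visits G"
  by (auto simp: remove_arcs_def visits_def fun_eq_iff)

section \<open>Eliminating the nodes outside a feedback vertex set\<close>

text \<open>Walks that stop at their first return to \<open>T\<close>; the starting point \<open>u\<close> itself does not
  count as a visit.\<close>

definition (in pre_digraph) first_passages :: "'a set \<Rightarrow> 'a \<Rightarrow> 'a \<Rightarrow> 'b list set" where
  "first_passages T u t = {p. p \<noteq> [] \<and> awalk u p t \<and> t \<in> T \<and> tail G ` set (tl p) \<inter> T = {}}"

text \<open>In the application \<open>T\<close> consists of the 0 node and the pseudo-common node, and the digraph
  is the metatile-generating digraph without its errant loops.\<close>

locale feedback_vertex_set = fin_digraph +
  fixes T :: "'a set"
  assumes T_subset: "T \<subseteq> verts G"
    and cycle_meets: "cycle p \<Longrightarrow> tail G ` set p \<inter> T \<noteq> {}"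
begin

text \<open>Every closed walk contains a cycle. Applied to the subgraph of the arcs that leave nodes
  outside \<open>T\<close>, this extends the hypothesis from cycles to closed walks.\<close>

lemma closed_walk_meets:
  assumes "awalk u p u" "p \<noteq> []"
  shows "tail G ` set p \<inter> T \<noteq> {}"
proof
  assume avoid: "tail G ` set p \<inter> T = {}"
  define A where "A = {a \<in> arcs G. tail G a \<notin> T}"
  have A: "A \<subseteq> arcs G" by (auto simp: A_def)
  interpret H: wf_digraph "G\<lparr>arcs := A\<rparr>"
    by unfold_locales (auto simp: A_def)
  have "set p \<subseteq> A" using assms avoid by (auto simp: A_def awalk_def)
  then have "H.closed_w p" using assms by (auto simp: H.closed_w_def awalk_arcs_update[OF A])
  then obtain c where "H.cycle c" using H.closed_w_imp_cycle by blast
  then have "cycle c" "tail G ` set c \<inter> T = {}"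
    unfolding cycle_arcs_update[OF A] by (auto simp: A_def)
  then show False using cycle_meets by blast
qed

text \<open>Well-foundedness of the step from a node outside \<open>T\<close> to its successors is what makes the
  elimination below terminate.\<close>

lemma wf_outside: "wf {(head G a, tail G a) |a. a \<in> arcs G \<and> tail G a \<notin> T}" (is "wf ?R")
proof (rule finite_acyclic_wf)
  have "?R = (\<lambda>a. (head G a, tail G a)) ` {a \<in> arcs G. tail G a \<notin> T}" by auto
  then show "finite ?R" by simp
  have walk: "\<exists>p. p \<noteq> [] \<and> awalk y p x \<and> tail G ` set p \<inter> T = {}" if "(x, y) \<in> ?R\<^sup>+" for x y
    using that
  proof (induction rule: trancl_induct)
    case (base y)
    then obtain a where "a \<in> arcs G" "tail G a \<notin> T" "x = head G a" "y = tail G a" by blast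
    then show ?case by (intro exI[of _ "[a]"]) (auto simp: awalk_simps)
  next
    case (step y z)
    then obtain a p where "a \<in> arcs G" "tail G a \<notin> T" "y = head G a" "z = tail G a"
      "awalk y p x" "tail G ` set p \<inter> T = {}" by blast
    then show ?case by (intro exI[of _ "a # p"]) (auto simp: awalk_simps)
  qed
  show "acyclic ?R"
    using walk closed_walk_meets unfolding acyclic_def by blast
qed

text \<open>A repeated node would cut out a closed walk avoiding \<open>T\<close>.\<close>

lemma first_passages_distinct:
  assumes p: "p \<in> first_passages T u t"
  shows "distinct (tl (awalk_verts u p))"
proof -
  obtain a q where aq: "p = a # q" "awalk (head G a) q t" "tail G ` set q \<inter> T = {}"
    using p by (cases p) (auto simp: first_passages_def awalk_Cons_iff)
  have "distinct (awalk_verts (head G a) q)"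
  proof (rule ccontr)
    assume "\<not> distinct (awalk_verts (head G a) q)"
    from awalk_cyc_decompE'[OF aq(2) this] obtain q1 r q2
      where "q = q1 @ r @ q2" "closed_w r" by metis
    then show False
      using closed_walk_meets[of _ r] aq(3) unfolding closed_w_def by auto
  qed
  then show ?thesis by (simp add: aq)
qed

lemma first_passages_eq_apaths:
  assumes "T = {u, t}" "u \<noteq> t"
  shows "first_passages T u t = {p. apath u p t}"
proof (intro equalityI subsetI)
  fix p assume p: "p \<in> first_passages T u t"
  obtain a q where aq: "p = a # q" "awalk u p t" "awalk (head G a) q t" "tail G ` set q \<inter> T = {}"
    using p by (cases p) (auto simp: first_passages_def awalk_Cons_iff)
  have "awalk_verts (head G a) q = map (tail G) q @ [t]"
    by (rule awalk_verts_eq_tails) (use aq in \<open>auto simp: awalk_def\<close>)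
  then have "u \<notin> set (tl (awalk_verts u p))"
    using aq assms by auto
  moreover have "awalk_verts u p = u # tl (awalk_verts u p)"
    using aq by (auto simp: awalk_Cons_iff)
  ultimately have "distinct (awalk_verts u p)"
    using first_passages_distinct[OF p] by (metis distinct.simps(2))
  then show "p \<in> {p. apath u p t}" using aq by (simp add: apath_def)
next
  fix p assume "p \<in> {p. apath u p t}"
  then have p: "apath u p t" by simp
  obtain a q where aq: "p = a # q"
    using p assms(2) by (cases p) (auto simp: apath_Nil_iff)
  have "awalk_verts u p = map (tail G) p @ [t]"
    by (rule awalk_verts_eq_tails) (use p in \<open>auto simp: apath_def awalk_def\<close>)
  then show "p \<in> first_passages T u t"
    using p unfolding aq by (auto simp: apath_def awalk_Cons_iff first_passages_def assms)
qed

lemma first_passages_eq_cycles: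
  assumes "u \<in> T"
  shows "first_passages T u u =
    {p. p \<noteq> [] \<and> awalk u p u \<and> distinct (map (tail G) p) \<and> tail G ` set p \<inter> T = {u}}"
proof (intro equalityI subsetI)
  fix p assume p: "p \<in> first_passages T u u"
  obtain a q where aq: "p = a # q" "awalk u p u" "awalk (head G a) q u" "tail G ` set q \<inter> T = {}"
    using p by (cases p) (auto simp: first_passages_def awalk_Cons_iff)
  have "awalk_verts u p = map (tail G) p @ [u]"
    by (rule awalk_verts_eq_tails) (use aq in \<open>auto simp: awalk_def\<close>)
  then have "distinct (map (tail G) q)" using first_passages_distinct[OF p] by (simp add: aq(1))
  moreover have "tail G a = u" using aq by (auto simp: awalk_Cons_iff)
  ultimately show "p \<in> {p. p \<noteq> [] \<and> awalk u p u \<and> distinct (map (tail G) p) \<and>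
      tail G ` set p \<inter> T = {u}}"
    using aq assms by auto
next
  fix p assume "p \<in> {p. p \<noteq> [] \<and> awalk u p u \<and> distinct (map (tail G) p) \<and>
      tail G ` set p \<inter> T = {u}}"
  then have p: "p \<noteq> []" "awalk u p u" "distinct (map (tail G) p)" "tail G ` set p \<inter> T = {u}"
    by blast+
  then obtain a q where aq: "p = a # q" "tail G a = u"
    by (cases p) (auto simp: awalk_Cons_iff)
  have "u \<notin> tail G ` set q" using p(3) aq by simp
  moreover have "tail G ` set q \<inter> T \<subseteq> {u}" using p(4) aq by auto
  ultimately have "tail G ` set (tl p) \<inter> T = {}" by (auto simp: aq(1))
  then show "p \<in> first_passages T u u"
    using assms p unfolding first_passages_def by blast
qed

text \<open>Elimination of the unknowns outside \<open>T\<close> from a linear system. Substituting the equation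
  of \<open>v\<close> into the others amounts to moving one arc ahead; as no walk can stay outside \<open>T\<close> for ever,
  the substitution ends with a combination of the unknowns in \<open>T\<close>, whose coefficients collect the
  weights of all walks up to their arrival in \<open>T\<close>. Finiteness is proved along with the identity,
  since the sums are meaningful over finite sets only.\<close>

lemma finite_first_passages_and_expansion:
  fixes wt :: "'b \<Rightarrow> 'c :: comm_semiring_1" and h :: "'a \<Rightarrow> 'c"
  defines "hits \<equiv> \<lambda>v t. {p. awalk v p t \<and> t \<in> T \<and> tail G ` set p \<inter> T = {}}"
  assumes h: "\<And>v. v \<in> verts G - T \<Longrightarrow> h v = (\<Sum>a\<in>out_arcs G v. wt a * h (head G a))"
    and u: "u \<in> verts G"
  shows "(\<forall>t. finite (first_passages T u t)) \<and>
    (\<Sum>a\<in>out_arcs G u. wt a * h (head G a)) =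
      (\<Sum>t\<in>T. (\<Sum>p\<in>first_passages T u t. \<Prod>a\<leftarrow>p. wt a) * h t)"
proof -
  have finT: "finite T" by (rule finite_subset[OF T_subset]) simp
  define W where "W p = (\<Prod>a\<leftarrow>p. wt a)" for p
  have fin_out: "finite (out_arcs G v)" for v by (simp add: out_arcs_def)
  \<comment> \<open>\<open>hits v t\<close> differs from \<open>first_passages T v t\<close> in that the start counts as a visit, so that
    it is trivial for \<open>v \<in> T\<close>; a first passage is an arc followed by such a walk.\<close>
  have step: "(\<forall>t. finite (first_passages T v t)) \<and>
    (\<Sum>a\<in>out_arcs G v. wt a * h (head G a)) =
      (\<Sum>t\<in>T. (\<Sum>p\<in>first_passages T v t. W p) * h t)"
    if v: "v \<in> verts G" and IH: "\<And>a. a \<in> out_arcs G v \<Longrightarrow> (\<forall>t. finite (hits (head G a) t)) \<and>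
      h (head G a) = (\<Sum>t\<in>T. (\<Sum>p\<in>hits (head G a) t. W p) * h t)" for v
  proof -
    have eq: "first_passages T v t = (\<Union>a\<in>out_arcs G v. (#) a ` hits (head G a) t)" for t
    proof -
      have "p \<in> first_passages T v t \<longleftrightarrow> p \<in> (\<Union>a\<in>out_arcs G v. (#) a ` hits (head G a) t)" for p
        by (cases p) (auto simp: first_passages_def hits_def awalk_Cons_iff disjoint_iff)
      then show ?thesis by blast
    qed
    have fin: "finite (first_passages T v t)" for t
      unfolding eq using IH fin_out by auto
    have sum: "(\<Sum>p\<in>first_passages T v t. W p) =
        (\<Sum>a\<in>out_arcs G v. wt a * (\<Sum>p\<in>hits (head G a) t. W p))" for t
    proof -
      have "(\<Sum>p\<in>first_passages T v t. W p) =
          (\<Sum>a\<in>out_arcs G v. \<Sum>p\<in>(#) a ` hits (head G a) t. W p)"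
        unfolding eq by (rule sum.UNION_disjoint) (use IH fin_out in auto)
      also have "\<dots> = (\<Sum>a\<in>out_arcs G v. wt a * (\<Sum>p\<in>hits (head G a) t. W p))"
        by (intro sum.cong refl, subst sum.reindex) (auto simp: W_def sum_distrib_left)
      finally show ?thesis .
    qed
    have "(\<Sum>a\<in>out_arcs G v. wt a * h (head G a)) =
        (\<Sum>a\<in>out_arcs G v. wt a * (\<Sum>t\<in>T. (\<Sum>p\<in>hits (head G a) t. W p) * h t))"
      by (intro sum.cong refl) (use IH in metis)
    also have "\<dots> = (\<Sum>a\<in>out_arcs G v. \<Sum>t\<in>T. wt a * (\<Sum>p\<in>hits (head G a) t. W p) * h t)"
      by (intro sum.cong refl, subst sum_distrib_left) (simp only: mult.assoc)
    also have "\<dots> = (\<Sum>t\<in>T. \<Sum>a\<in>out_arcs G v. wt a * (\<Sum>p\<in>hits (head G a) t. W p) * h t)"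
      by (rule sum.swap)
    finally show ?thesis using fin by (simp add: sum sum_distrib_right)
  qed
  have hits: "(\<forall>t. finite (hits v t)) \<and> h v = (\<Sum>t\<in>T. (\<Sum>p\<in>hits v t. W p) * h t)"
    if "v \<in> verts G" for v
    using wf_outside that
  proof (induction v rule: wf_induct_rule)
    case (less v)
    show ?case
    proof (cases "v \<in> T")
      case True
      have hits_v: "hits v t = (if t = v then {[]} else {})" for t
      proof -
        have "p \<in> hits v t \<longleftrightarrow> p = [] \<and> t = v" for p
          using True less.prems by (cases p) (auto simp: hits_def awalk_simps)
        then show ?thesis by auto
      qed
      have "(\<Sum>t\<in>T. (\<Sum>p\<in>hits v t. W p) * h t) = (\<Sum>t\<in>T. if t = v then h t else 0)"
        by (intro sum.cong refl) (simp add: hits_v W_def)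
      also have "\<dots> = h v" using True finT by simp
      finally show ?thesis by (simp add: hits_v)
    next
      case False
      have hits_v: "hits v t = first_passages T v t" for t
      proof -
        have "p \<in> hits v t \<longleftrightarrow> p \<in> first_passages T v t" for p
          using False by (cases p) (auto simp: hits_def first_passages_def awalk_simps)
        then show ?thesis by blast
      qed
      have "(\<forall>t. finite (first_passages T v t)) \<and>
        (\<Sum>a\<in>out_arcs G v. wt a * h (head G a)) =
          (\<Sum>t\<in>T. (\<Sum>p\<in>first_passages T v t. W p) * h t)"
        by (rule step[OF less.prems], rule less.IH) (use False in auto)
      then show ?thesis using h[of v] False less.prems by (simp add: hits_v)
    qed
  qed
  show ?thesis
    using step[OF u hits] by (auto simp: W_def)
qed

lemma finite_first_passages: "u \<in> verts G \<Longrightarrow> finite (first_passages T u t)"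
  using finite_first_passages_and_expansion[where wt = "\<lambda>_. 0 :: nat" and h = "\<lambda>_. 0" and u = u] by simp

lemma first_passage_expansion:
  fixes wt :: "'b \<Rightarrow> 'c :: comm_semiring_1"
  assumes "\<And>v. v \<in> verts G - T \<Longrightarrow> h v = (\<Sum>a\<in>out_arcs G v. wt a * h (head G a))"
    and "u \<in> verts G"
  shows "(\<Sum>a\<in>out_arcs G u. wt a * h (head G a)) =
    (\<Sum>t\<in>T. (\<Sum>p\<in>first_passages T u t. \<Prod>a\<leftarrow>p. wt a) * h t)"
  using finite_first_passages_and_expansion[of h wt u] assms by blast

end

section \<open>Cycles and circuits as first passages\<close>

locale pseudo_common_digraph =
  fixes Q :: "nat set" and E :: "arc set" and P :: node
  assumes Q: "finite Q" "Q \<noteq> {}" "\<forall>j\<in>Q. 0 < j"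
    and errant: "errant_loops_pseudo_common (metatile_digraph Q) E P"
    and one_errant_node:
      "\<forall>p \<in> outer_cycles (metatile_digraph Q) P \<union> non_errant_inner_cycles (metatile_digraph Q) E \<union>
         common_circuits (metatile_digraph Q) P.
         \<not> plain (metatile_digraph Q) E p \<longrightarrow> length (errant_visits (metatile_digraph Q) E p) = 1"
begin

abbreviation G where "G \<equiv> metatile_digraph Q"
abbreviation G' where "G' \<equiv> remove_arcs G E"

text \<open>Adding a square shortens the string of a nonzero node, so an errant loop adds a comb. Hence
  a node carries at most one errant loop.\<close>

lemma errant_loop:
  assumes "a \<in> E"
  shows "fst a \<in> nodes Q" "add_tile Q (fst a) (snd a) = fst a" "fst a \<noteq> []" "snd a = Comb"
    "0 < walk_length Q [a]"
proof -
  have "[a] \<in> cycles G" "fst a \<noteq> []"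
    using errant assms by (auto simp: errant_loops_pseudo_common_def inner_cycles_def visits_def)
  then show a: "fst a \<in> nodes Q" "add_tile Q (fst a) (snd a) = fst a" "fst a \<noteq> []"
    and "0 < walk_length Q [a]"
    using metatile.cycle_if_in_cycles[of "[a]" Q] closed_walk_length_pos[of Q "fst a" "[a]"]
    by (auto simp: metatile.cycle_iff metatile.awalk_simps)
  have "length (fst a) - 1 < length (fst a)" using a(3) by simp
  then show "snd a = Comb"
    using length_add_tile_Square[of Q "fst a"] a(2) by (cases "snd a") auto
qed

lemma P_node: "P \<in> nodes Q" "P \<noteq> []"
  using errant by (auto simp: errant_loops_pseudo_common_def common_node_def)

lemma inner_cycle_visits_P:
  assumes "p \<in> cycles G'" "[] \<notin> set (visits G p)"
  shows "P \<in> set (visits G p)"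
  using errant assms by (auto simp: errant_loops_pseudo_common_def common_node_def inner_cycles_def)

lemma wf_loopless: "wf_digraph G'"
proof (rule wf_digraph.intro)
  fix a assume "a \<in> arcs G'"
  then have "fst a \<in> nodes Q" by (simp add: mem_Times_iff)
  then show "tail G' a \<in> verts G'" "head G' a \<in> verts G'" by (simp_all add: nodes.step)
qed

text \<open>Here the pseudo-common node does its work: without the errant loops, a cycle either visits
  the 0 node or is an inner cycle, and then it visits \<open>P\<close>.\<close>

lemma cycle_meets_loopless:
  assumes "pre_digraph.cycle G' p"
  shows "tail G' ` set p \<inter> {[], P} \<noteq> {}"
proof -
  have "cycle_representative p \<in> cycles G'"
    unfolding cycles_conv using assms by blast
  then have "[] \<in> set (visits G (cycle_representative p)) \<or> P \<in> set (visits G (cycle_representative p))"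
    using inner_cycle_visits_P by blast
  then show ?thesis by (auto simp: visits_def)
qed

sublocale loopless: feedback_vertex_set G' "{[], P}"
proof (intro feedback_vertex_set.intro fin_digraph.intro wf_loopless
    fin_digraph_axioms.intro feedback_vertex_set_axioms.intro)
  show "finite (verts G')" by (simp add: finite_nodes)
  show "finite (arcs G')" by (simp add: finite_nodes UNIV_tile)
  show "{[], P} \<subseteq> verts G'" by (simp add: P_node nodes.zero)
qed (rule cycle_meets_loopless)

lemma cycle_avoids_errant_loops:
  assumes "p \<in> cycles G" "\<And>a. a \<in> E \<Longrightarrow> p \<noteq> [a]"
  shows "p \<in> cycles G'"
proof -
  have "a \<notin> E" if "a \<in> set p" for a
  proof
    assume "a \<in> E"
    then have "head G a = tail G a" by (simp add: errant_loop(2))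
    with metatile.cycle_if_in_cycles[OF assms(1)] that have "p = [a]"
      by (rule metatile.cycle_through_loop)
    then show False using assms(2) \<open>a \<in> E\<close> by blast
  qed
  then have "set p \<inter> E = {}" by blast
  then show ?thesis using assms(1) by (simp add: metatile.cycles_remove_arcs)
qed

lemma outer_cycles_eq:
  "outer_cycles G P = {p \<in> cycles G'. [] \<in> set (visits G' p) \<and> P \<notin> set (visits G' p)}"
proof -
  have "p \<in> cycles G'" if "p \<in> cycles G" "[] \<in> set (visits G p)" for p
  proof (rule cycle_avoids_errant_loops[OF that(1)])
    show "p \<noteq> [a]" if "a \<in> E" for a
      using errant_loop(3)[OF that] \<open>[] \<in> set (visits G p)\<close> by (auto simp: visits_def)
  qed
  then show ?thesis by (auto simp: outer_cycles_def metatile.cycles_remove_arcs)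
qed

lemma non_errant_inner_cycles_eq:
  "non_errant_inner_cycles G E = {p \<in> cycles G'. P \<in> set (visits G' p) \<and> [] \<notin> set (visits G' p)}"
proof (intro equalityI subsetI)
  fix p assume "p \<in> non_errant_inner_cycles G E"
  then have p: "p \<in> cycles G" "[] \<notin> set (visits G p)" "\<And>a. a \<in> E \<Longrightarrow> p \<noteq> [a]"
    by (auto simp: non_errant_inner_cycles_def inner_cycles_def)
  then have "p \<in> cycles G'" by (intro cycle_avoids_errant_loops) auto
  then show "p \<in> {p \<in> cycles G'. P \<in> set (visits G' p) \<and> [] \<notin> set (visits G' p)}"
    using p inner_cycle_visits_P by simp
next
  fix p assume "p \<in> {p \<in> cycles G'. P \<in> set (visits G' p) \<and> [] \<notin> set (visits G' p)}"
  then show "p \<in> non_errant_inner_cycles G E"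
    by (auto simp: non_errant_inner_cycles_def inner_cycles_def metatile.cycles_remove_arcs)
qed

lemma apath_loopless: "pre_digraph.apath G' u p v \<longleftrightarrow> pre_digraph.apath G u p v"
proof -
  have "set p \<inter> E = {}" if "pre_digraph.apath G u p v"
  proof -
    have "a \<notin> E" if "a \<in> set p" for a
    proof -
      have "add_tile Q (fst a) (snd a) \<noteq> fst a"
        using metatile.no_loops_in_apath[OF \<open>pre_digraph.apath G u p v\<close> that]
        unfolding metatile_digraph_simps by (rule not_sym)
      then show ?thesis using errant_loop(2) by blast
    qed
    then show ?thesis by blast
  qed
  then show ?thesis
    unfolding pre_digraph.apath_def metatile.awalk_remove_arcs
    by (auto simp: remove_arcs_def)
qed

lemma common_circuits_eq:
  "common_circuits G P = (\<lambda>(p, q). p @ q) `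
     (loopless.first_passages {[], P} [] P \<times> loopless.first_passages {[], P} P [])"
proof -
  have "loopless.first_passages {[], P} [] P = {p. pre_digraph.apath G [] p P}"
    using loopless.first_passages_eq_apaths[OF refl P_node(2)[symmetric]] by (simp only: apath_loopless)
  moreover have "loopless.first_passages {[], P} P [] = {p. pre_digraph.apath G P p []}"
    using loopless.first_passages_eq_apaths[OF insert_commute P_node(2)] by (simp only: apath_loopless)
  ultimately show ?thesis unfolding common_circuits_def by auto
qed

text \<open>The first half of a common circuit ends at the only visit of \<open>P\<close>, so it can be read off
  from the concatenation.\<close>

lemma inj_on_circuit:
  "inj_on (\<lambda>(p, q). p @ q)
     (loopless.first_passages {[], P} [] P \<times> loopless.first_passages {[], P} P [])"
proof -
  have "takeWhile (\<lambda>a. fst a \<noteq> P) (p @ q) = p"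
    if p: "p \<in> loopless.first_passages {[], P} [] P" and q: "q \<in> loopless.first_passages {[], P} P []"
    for p q
  proof -
    obtain b q' where "q = b # q'" "fst b = P"
      using q by (cases q) (auto simp: loopless.first_passages_def loopless.awalk_Cons_iff)
    moreover have "fst a \<noteq> P" if a: "a \<in> set p" for a
    proof -
      obtain c p' where p': "p = c # p'" "fst c = []"
        using p by (cases p) (auto simp: loopless.first_passages_def loopless.awalk_Cons_iff)
      have "P \<notin> fst ` set p'"
        using p p' by (auto simp: loopless.first_passages_def disjoint_iff)
      then show ?thesis using a p' P_node(2) by auto
    qed
    ultimately show ?thesis by (simp add: takeWhile_append2)
  qed
  then show ?thesis by (intro inj_onI) (clarsimp, metis append_eq_append_conv)
qed

section \<open>Absorbing the errant loops into the weights\<close>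

definition errant_loop_gf :: "node \<Rightarrow> bivariate" where
  "errant_loop_gf v = (\<Sum>a \<in> {a \<in> E. fst a = v}. walk_monomial Q [a])"

text \<open>The geometric series of all numbers of turns that a walk visiting \<open>v\<close> may take on the
  errant loop there.\<close>

definition loop_factor :: "node \<Rightarrow> bivariate" where
  "loop_factor v = 1 / (1 - errant_loop_gf v)"

definition arc_weight :: "arc \<Rightarrow> bivariate" where
  "arc_weight a = loop_factor (fst a) * walk_monomial Q [a]"

definition walk_weight :: "arc list \<Rightarrow> bivariate" where
  "walk_weight p = (\<Prod>a\<leftarrow>p. arc_weight a)"

lemma loop_factor_mult: "loop_factor v * (1 - errant_loop_gf v) = 1"
  unfolding loop_factor_def
  by (rule one_divide_mult_self)
    (simp add: errant_loop_gf_def fps_sum_nth walk_monomial_nth_0[OF errant_loop(5)])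

lemma loop_factor_eq_1: "v \<notin> fst ` E \<Longrightarrow> loop_factor v = 1"
proof -
  assume "v \<notin> fst ` E"
  then have "{a \<in> E. fst a = v} = {}" by force
  then have "errant_loop_gf v = 0" by (simp only: errant_loop_gf_def sum.empty)
  then show ?thesis using loop_factor_mult[of v] by simp
qed

lemma walk_weight_eq: "walk_weight p = walk_monomial Q p * (\<Prod>v\<leftarrow>visits G p. loop_factor v)"
proof (induction p)
  case (Cons a p)
  then show ?case
    by (subst walk_monomial_Cons) (simp add: walk_weight_def arc_weight_def visits_def mult_ac)
qed (simp add: walk_weight_def visits_def)

lemma walk_weight_append: "walk_weight (p @ q) = walk_weight p * walk_weight q"
  by (simp add: walk_weight_def)

lemma walk_weight_rotate: "walk_weight (rotate m p) = walk_weight p"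
proof (induction m)
  case (Suc m)
  have "walk_weight (rotate1 q) = walk_weight q" for q
    by (cases q) (simp_all add: walk_weight_def mult.commute)
  then show ?case using Suc by simp
qed simp

lemma walk_weight_nth_0:
  assumes "pre_digraph.awalk G v p v" "p \<noteq> []"
  shows "fps_nth (walk_weight p) 0 = 0"
  using walk_monomial_nth_0[OF closed_walk_length_pos[OF assms]] by (simp add: walk_weight_eq)

lemma prod_loop_factor_errant:
  "(\<Prod>v\<leftarrow>visits G p. loop_factor v) = (\<Prod>v\<leftarrow>errant_visits G E p. loop_factor v)"
proof -
  have "(\<Prod>v\<leftarrow>vs. loop_factor v) = (\<Prod>v\<leftarrow>filter (\<lambda>v. v \<in> fst ` E) vs. loop_factor v)" for vs
    by (induction vs) (auto simp: loop_factor_eq_1)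
  then show ?thesis by (simp add: errant_visits_def errant_loop_nodes_def)
qed

lemma walk_weight_plain: "plain G E p \<Longrightarrow> walk_weight p = walk_monomial Q p"
proof -
  assume "plain G E p"
  then have "errant_visits G E p = []"
    by (auto simp: plain_def errant_visits_def filter_empty_conv)
  then show ?thesis by (simp add: walk_weight_eq prod_loop_factor_errant)
qed

text \<open>A visit of a node without an errant loop contributes the factor 1, so exactly one factor
  remains, and it belongs to the associated errant loop.\<close>

lemma walk_weight_non_plain:
  assumes "length (errant_visits G E p) = 1"
  shows "walk_weight p =
    walk_monomial Q p / (1 - walk_monomial Q [associated_errant_loop G E p])"
proof -
  obtain v where v: "errant_visits G E p = [v]"
    using assms by (auto simp: length_Suc_conv)
  have iff: "u \<in> set (visits G p) \<and> u \<in> fst ` E \<longleftrightarrow> u = v" for u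
  proof -
    have "set (errant_visits G E p) = {u \<in> set (visits G p). u \<in> fst ` E}"
      by (auto simp: errant_visits_def errant_loop_nodes_def)
    then show ?thesis using v by auto
  qed
  obtain a where a: "a \<in> E" "fst a = v" using iff[of v] by auto
  have unique: "b = a" if "b \<in> E" "fst b = v" for b
    using errant_loop(4)[OF that(1)] errant_loop(4)[OF a(1)] a that by (simp add: prod_eq_iff)
  have "associated_errant_loop G E p = a"
    unfolding associated_errant_loop_def
  proof (rule the_equality)
    show "a \<in> E \<and> tail G a \<in> set (visits G p)" using a iff[of v] by simp
    fix b assume b: "b \<in> E \<and> tail G b \<in> set (visits G p)"
    then have "fst b = v" using iff[of "fst b"] by simp
    then show "b = a" using b unique by blast
  qed
  moreover have "errant_loop_gf v = walk_monomial Q [a]"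
  proof -
    have "{b \<in> E. fst b = v} = {a}"
    proof (intro set_eqI iffI)
      show "b \<in> {a}" if "b \<in> {b \<in> E. fst b = v}" for b using that unique[of b] by simp
    qed (use a in simp)
    then show ?thesis by (simp add: errant_loop_gf_def)
  qed
  moreover have "fps_nth (1 - walk_monomial Q [a]) 0 = 1"
    using walk_monomial_nth_0[OF errant_loop(5)[OF a(1)]] by simp
  ultimately show ?thesis
    unfolding walk_weight_eq prod_loop_factor_errant v
    by (simp add: loop_factor_def divide_eq_mult_inverse[of _ "walk_monomial Q p"])
qed

lemma sum_plain_non_plain:
  assumes "finite X"
    and "X \<subseteq> outer_cycles G P \<union> non_errant_inner_cycles G E \<union> common_circuits G P"
  shows "(\<Sum>p \<in> {p \<in> X. plain G E p}. walk_monomial Q p) +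
      (\<Sum>p \<in> {p \<in> X. \<not> plain G E p}.
         walk_monomial Q p / (1 - walk_monomial Q [associated_errant_loop G E p])) =
    (\<Sum>p\<in>X. walk_weight p)"
proof -
  have "(\<Sum>p\<in>X. walk_weight p) =
      (\<Sum>p\<in>{p \<in> X. plain G E p}. walk_weight p) + (\<Sum>p\<in>{p \<in> X. \<not> plain G E p}. walk_weight p)"
    by (subst sum.union_disjoint[symmetric]) (use assms(1) in \<open>auto intro: sum.cong\<close>)
  moreover have "(\<Sum>p\<in>{p \<in> X. plain G E p}. walk_weight p) =
      (\<Sum>p\<in>{p \<in> X. plain G E p}. walk_monomial Q p)"
    by (rule sum.cong) (auto simp: walk_weight_plain)
  moreover have "(\<Sum>p\<in>{p \<in> X. \<not> plain G E p}. walk_weight p) = (\<Sum>p\<in>{p \<in> X. \<not> plain G E p}.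
         walk_monomial Q p / (1 - walk_monomial Q [associated_errant_loop G E p]))"
    by (intro sum.cong refl walk_weight_non_plain) (use assms(2) one_errant_node in blast)
  ultimately show ?thesis by simp
qed

abbreviation passages :: "node \<Rightarrow> node \<Rightarrow> arc list set" where
  "passages \<equiv> loopless.first_passages {[], P}"

abbreviation passage_gf :: "node \<Rightarrow> node \<Rightarrow> bivariate" where
  "passage_gf u t \<equiv> (\<Sum>p\<in>passages u t. walk_weight p)"

lemma finite_passages: "finite (passages [] t)" "finite (passages P t)"
  using loopless.finite_first_passages[of "[]"] loopless.finite_first_passages[of P]
  by (auto simp: P_node nodes.zero)

lemma passages_cycles:
  assumes "u \<in> {[], P}" "{u, v} = {[], P}" "u \<noteq> v"
  shows "passages u u = {p. p \<noteq> [] \<and> loopless.awalk u p u \<and> distinct (map (tail G') p) \<and>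
    v \<notin> tail G' ` set p}"
proof -
  have "u \<in> tail G' ` set p" if "p \<noteq> []" "loopless.awalk u p u" for p
    using that by (cases p) (auto simp: loopless.awalk_Cons_iff)
  moreover have "S \<inter> {u, v} = {u} \<longleftrightarrow> v \<notin> S" if "u \<in> S" for S :: "node set"
    using that assms(3) by auto
  ultimately have *: "tail G' ` set p \<inter> {u, v} = {u} \<longleftrightarrow> v \<notin> tail G' ` set p"
    if "p \<noteq> []" "loopless.awalk u p u" for p
    using that by metis
  show ?thesis
    unfolding loopless.first_passages_eq_cycles[OF assms(1)] unfolding assms(2)[symmetric]
    by (intro Collect_cong conj_cong refl *)
qed

text \<open>For \<open>u\<close> the 0 node these are the outer cycles; for \<open>u = P\<close> the inner cycles other than
  errant loops.\<close>

lemma cycles_sum_eq_passage_gf: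
  assumes "{u, v} = {[], P}" "u \<noteq> v"
  defines "X \<equiv> {p \<in> cycles G'. u \<in> set (visits G' p) \<and> v \<notin> set (visits G' p)}"
  shows "finite X" "(\<Sum>p\<in>X. walk_weight p) = passage_gf u u"
proof -
  have u: "u \<in> {[], P}" using assms(1) by blast
  note eq = passages_cycles[OF u assms(1,2)]
  have "finite (passages u u)" using u finite_passages by blast
  then show "finite X"
    unfolding X_def eq
    using bij_betw_finite[OF loopless.bij_betw_cycles_through[of u "\<lambda>S. v \<notin> S"]] by blast
  show "(\<Sum>p\<in>X. walk_weight p) = passage_gf u u"
    unfolding X_def eq
    by (rule loopless.sum_cycles_through[of walk_weight u "\<lambda>S. v \<notin> S"]) (rule walk_weight_rotate)
qed

lemma circuits_sum_eq:
  "finite (common_circuits G P)"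
  "(\<Sum>p\<in>common_circuits G P. walk_weight p) = passage_gf [] P * passage_gf P []"
proof -
  show "finite (common_circuits G P)"
    unfolding common_circuits_eq by (simp add: finite_passages)
  show "(\<Sum>p\<in>common_circuits G P. walk_weight p) = passage_gf [] P * passage_gf P []"
    unfolding common_circuits_eq
    by (subst sum.reindex[OF inj_on_circuit])
      (simp add: sum_product sum.cartesian_product walk_weight_append case_prod_unfold)
qed

text \<open>Solving the equation of \<open>v\<close> for the multiple of its own unknown that comes from the errant
  loop multiplies the weights of all other arcs leaving \<open>v\<close> by the loop factor. There is no errant
  loop at the 0 node, so the constant term of its equation stays 1.\<close>

lemma walks_gf_loopless:
  assumes "v \<in> nodes Q"
  shows "walks_gf Q v = of_bool (v = []) +
    (\<Sum>a\<in>out_arcs G' v. arc_weight a * walks_gf Q (head G' a))"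
proof -
  have out: "out_arcs G v = out_arcs G' v \<union> {a \<in> E. fst a = v}"
    using errant_loop(1) by (auto simp: out_arcs_def mem_Times_iff)
  have fin: "finite (out_arcs G v)" using out_arcs_metatile[OF assms] by (simp add: UNIV_tile)
  let ?S = "\<Sum>a\<in>out_arcs G' v. walk_monomial Q [a] * walks_gf Q (head G' a)"
  have "walks_gf Q v = of_bool (v = []) +
      (\<Sum>a\<in>out_arcs G v. walk_monomial Q [a] * walks_gf Q (head G a))"
    by (rule walks_gf_first_arc[OF assms])
  also have "(\<Sum>a\<in>out_arcs G v. walk_monomial Q [a] * walks_gf Q (head G a)) =
      ?S + (\<Sum>a\<in>{a \<in> E. fst a = v}. walk_monomial Q [a] * walks_gf Q (head G a))"
    unfolding out by (subst sum.union_disjoint) (use fin in \<open>auto simp: out\<close>)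
  also have "(\<Sum>a\<in>{a \<in> E. fst a = v}. walk_monomial Q [a] * walks_gf Q (head G a)) =
      errant_loop_gf v * walks_gf Q v"
    unfolding errant_loop_gf_def sum_distrib_right
    by (rule sum.cong) (auto dest: errant_loop(2))
  finally have "(1 - errant_loop_gf v) * walks_gf Q v = of_bool (v = []) + ?S"
    by (simp add: algebra_simps)
  from arg_cong[OF this, of "(*) (loop_factor v)"]
  have "loop_factor v * (1 - errant_loop_gf v) * walks_gf Q v =
      loop_factor v * of_bool (v = []) + loop_factor v * ?S"
    by (simp only: distrib_left mult.assoc)
  moreover have "loop_factor v * of_bool (v = []) = of_bool (v = [])"
  proof (cases "v = []")
    case True
    then have "v \<notin> fst ` E" using errant_loop(3) by force
    then show ?thesis by (simp add: loop_factor_eq_1)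
  qed simp
  moreover have "loop_factor v * ?S = (\<Sum>a\<in>out_arcs G' v. arc_weight a * walks_gf Q (head G' a))"
    unfolding sum_distrib_left
    by (rule sum.cong) (auto simp: arc_weight_def out_arcs_def mult.assoc)
  ultimately show ?thesis by (simp add: loop_factor_mult)
qed

section \<open>Solving for the 0 node\<close>

lemma walks_gf_passages:
  assumes "u \<in> nodes Q"
  shows "walks_gf Q u = of_bool (u = []) + passage_gf u [] * walks_gf Q [] + passage_gf u P * walks_gf Q P"
proof -
  have "(\<Sum>a\<in>out_arcs G' u. arc_weight a * walks_gf Q (head G' a)) =
      (\<Sum>t\<in>{[], P}. (\<Sum>p\<in>passages u t. \<Prod>a\<leftarrow>p. arc_weight a) * walks_gf Q t)"
    by (rule loopless.first_passage_expansion) (use assms walks_gf_loopless in auto)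
  then show ?thesis
    using walks_gf_loopless[OF assms] P_node(2) by (simp add: walk_weight_def add.assoc)
qed

lemma passage_gf_closed_nth_0: "fps_nth (passage_gf u u) 0 = 0"
proof -
  have "fps_nth (walk_weight p) 0 = 0" if "p \<in> passages u u" for p
    using that walk_weight_nth_0[of u p]
    by (simp add: loopless.first_passages_def metatile.awalk_remove_arcs)
  then show ?thesis by (simp add: fps_sum_nth)
qed

text \<open>The half from \<open>P\<close> to the 0 node may consist of squares only and then has length 0, but
  together the two halves form a closed walk.\<close>

lemma circuits_nth_0: "fps_nth (passage_gf [] P * passage_gf P []) 0 = 0"
proof -
  have "fps_nth (walk_weight p) 0 * fps_nth (walk_weight q) 0 = 0"
    if "p \<in> passages [] P" "q \<in> passages P []" for p q
  proof -
    have "pre_digraph.awalk G [] (p @ q) []" "p @ q \<noteq> []"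
      using that metatile.awalk_appendI[of Q "[]" p P q "[]"]
      by (auto simp: loopless.first_passages_def metatile.awalk_remove_arcs simp del: metatile.awalk_append_iff)
    from walk_weight_nth_0[OF this] show ?thesis by (simp add: walk_weight_append)
  qed
  then show ?thesis
    by (simp add: fps_sum_nth sum_product) (auto intro!: sum.neutral)
qed

text \<open>Two unknowns are left, and eliminating the one of \<open>P\<close> gives the result. The closed walks
  have positive length, so both denominators have \<open>x\<close>-constant term 1 and the divisions are
  genuine.\<close>

lemma tiling_gf_eq_passage_gfs:
  defines "D \<equiv> 1 - passage_gf P P"
  shows "tiling_gf Q = 1 / (1 - passage_gf [] [] - passage_gf [] P * passage_gf P [] / D)"
proof -
  let ?A = "passage_gf [] []" and ?B = "passage_gf [] P * passage_gf P []"
  let ?F = "1 - ?A - ?B / D"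
  have D0: "fps_nth D 0 = 1" by (simp add: D_def passage_gf_closed_nth_0)
  have BD: "?B / D * D = ?B" by (rule bivariate_divide_mult[OF D0])
  have "fps_nth (?B / D) 0 = 0"
    using arg_cong[OF BD, of "\<lambda>f. fps_nth f 0"] D0 circuits_nth_0 by simp
  then have F0: "fps_nth ?F 0 = 1" by (simp add: passage_gf_closed_nth_0)
  have h0: "walks_gf Q [] = 1 + ?A * walks_gf Q [] + passage_gf [] P * walks_gf Q P"
    using walks_gf_passages[OF nodes.zero] by simp
  have hP: "D * walks_gf Q P = passage_gf P [] * walks_gf Q []"
    using walks_gf_passages[OF P_node(1)] P_node(2) unfolding D_def
    by (simp add: algebra_simps)
  have "(1 - a - b) * h * d = d * (h - a * h) - b * d * h" for a b h d :: bivariate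
    by (simp add: algebra_simps)
  then have "?F * walks_gf Q [] * D = D * (walks_gf Q [] - ?A * walks_gf Q []) - ?B / D * D * walks_gf Q []"
    .
  also have "\<dots> = D * (walks_gf Q [] - ?A * walks_gf Q []) - passage_gf [] P * (D * walks_gf Q P)"
    unfolding BD hP by (simp only: mult.assoc)
  also have "\<dots> = D * (walks_gf Q [] - ?A * walks_gf Q [] - passage_gf [] P * walks_gf Q P)"
    by (simp only: algebra_simps)
  also have "walks_gf Q [] - ?A * walks_gf Q [] - passage_gf [] P * walks_gf Q P = 1"
    using h0 by (simp add: algebra_simps)
  finally have "?F * walks_gf Q [] = 1"
    using D0 by auto
  then have "1 / ?F = 1 / ?F * (?F * walks_gf Q [])" by simp
  also have "\<dots> = 1 / ?F * ?F * walks_gf Q []" by (simp only: mult.assoc)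
  also have "\<dots> = walks_gf Q []" by (simp only: one_divide_mult_self[OF F0] mult_1_left)
  finally have "walks_gf Q [] = 1 / ?F" by (rule sym)
  moreover have "tiling_gf Q = walks_gf Q []"
    unfolding tiling_gf_def walks_gf_def num_tilings_eq_closed_walks[OF Q] ..
  ultimately show ?thesis by simp
qed

end

theorem theorem6:
  fixes Q :: "nat set" and E :: "arc set" and P :: node
    and G :: digraph and A B D :: bivariate
  assumes Q: "finite Q" "Q \<noteq> {}" "\<forall>j\<in>Q. 0 < j"
    and G: "G = metatile_digraph Q"
    and errant: "errant_loops_pseudo_common G E P"
    and one_errant_node:
      "\<forall>p \<in> outer_cycles G P \<union> non_errant_inner_cycles G E \<union> common_circuits G P.
         \<not> plain G E p \<longrightarrow> length (errant_visits G E p) = 1"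
    and A: "A =
      (\<Sum>p \<in> {p \<in> outer_cycles G P. plain G E p}. walk_monomial Q p)
      + (\<Sum>p \<in> {p \<in> outer_cycles G P. \<not> plain G E p}.
           walk_monomial Q p / (1 - walk_monomial Q [associated_errant_loop G E p]))"
    and B: "B =
      (\<Sum>p \<in> {p \<in> common_circuits G P. plain G E p}. walk_monomial Q p)
      + (\<Sum>p \<in> {p \<in> common_circuits G P. \<not> plain G E p}.
           walk_monomial Q p / (1 - walk_monomial Q [associated_errant_loop G E p]))"
    and D: "D = 1
      - (\<Sum>p \<in> {p \<in> non_errant_inner_cycles G E. plain G E p}. walk_monomial Q p)
      - (\<Sum>p \<in> {p \<in> non_errant_inner_cycles G E. \<not> plain G E p}.
           walk_monomial Q p / (1 - walk_monomial Q [associated_errant_loop G E p]))"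
  shows "tiling_gf Q = 1 / (1 - A - B / D)"
proof -
  interpret pseudo_common_digraph Q E P
    using Q errant one_errant_node unfolding G by unfold_locales
  have P: "{P, []} = {[], P}" by blast
  note outer = cycles_sum_eq_passage_gf[OF refl P_node(2)[symmetric], folded outer_cycles_eq]
  note inner = cycles_sum_eq_passage_gf[OF P P_node(2), folded non_errant_inner_cycles_eq]
  have "A = passage_gf [] []"
    unfolding A G by (subst sum_plain_non_plain) (use outer in auto)
  moreover have "B = passage_gf [] P * passage_gf P []"
    unfolding B G by (subst sum_plain_non_plain) (use circuits_sum_eq in auto)
  moreover have "D = 1 - passage_gf P P"
    unfolding D G diff_diff_eq by (subst sum_plain_non_plain) (use inner in auto)
  ultimately show ?thesis using tiling_gf_eq_passage_gfs by simp
qed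

end
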